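(* Let $(T,d)$ be a metric space and $m$ a Borel probability measure on $T$ with $\operatorname{supp}(m)=T$. Let $a,b\ge 0$, $\varphi\in\mathcal{G}_{a,b}$ and $R\ge 2$; put $A=\frac{R^3}{(R-1)(R-2)}$, $B=\frac{R^2}{R-1}$ and $K=(aA+bB)\,\mathcal{S}$. Then there exists a probability measure $\nu$ on $T\times T$ which satisfies $$\left|f(t)-\int_T f(u)\,m(du)\right|\le aA\,\sigma(t)+bB\,\bar{\mathcal{S}}\int_{T\times T}\varphi\left(\frac{|f(u)-f(v)|}{d(u,v)}\right)\nu(du,dv)$$ for every bounded continuous $f:T\to\mathbb{R}$ and every $t\in T$, and for this $\nu$ the following holds. Let $\psi:\mathbb{R}_+\to\mathbb{R}$ be an increasing, continuous function with $\psi(0)=0$, and let $\alpha,\beta\ge 0$ be such that $$\psi(x)\le\alpha+\beta\frac{\varphi(xy)}{\varphi(y)}\qquad\text{for all }x\ge 0,\ y>0.$$ Then for each bounded continuous function $f:T\to\mathbb{R}$, $$\sup_{t\in T}\psi\left(\frac{\left|f(t)-\int_T f(u)\,m(du)\right|}{K}\right)\le\alpha+\beta\int_{T\times T}\varphi\left(\frac{|f(u)-f(v)|}{d(u,v)}\right)\nu(du,dv).$$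
   Context: $B(x,\varepsilon)=\{y\in T:d(x,y)\le\varepsilon\}$ is the closed ball and $D(T)=\sup\{d(s,t):s,t\in T\}$ the diameter of $T$ (possibly $+\infty$). For $a,b\ge0$, $\mathcal{G}_{a,b}$ is the class of all functions $\varphi:\mathbb{R}_+\to\mathbb{R}$ that are (strictly) increasing and continuous, satisfy $\varphi(0)=0$, and satisfy $x\le a+b\frac{\varphi(xy)}{\varphi(y)}$ for all $x\ge 0$, $y\ge\varphi^{-1}(1)$; it is understood that the inverse $\varphi^{-1}$ is defined on $[0,\infty)$. Define $\sigma(x)=\int_0^{D(T)}\varphi^{-1}\left(\frac{1}{m(B(x,\varepsilon))}\right)d\varepsilon\in[0,\infty]$, $\bar{\mathcal{S}}=\int_T\sigma(u)\,m(du)\in[0,\infty]$ and $\mathcal{S}=\sup_{x\in T}\sigma(x)\in[0,\infty]$. Conventions: $0/0=0$ (in particular the integrand equals $\varphi(0)=0$ on the diagonal $u=v$); for $R=2$, $A=+\infty$; $0\cdot\infty=0$; and a finite number divided by $+\infty$ is $0$. *)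

theory Defs
  imports "HOL-Probability.Probability"
begin

definition msupport :: "'a::topological_space measure \<Rightarrow> 'a set" where
  "msupport m = {x. \<forall>U. open U \<and> x \<in> U \<longrightarrow> emeasure m U > 0}"

text \<open>The library's \<open>diameter\<close> is real-valued; here unbounded sets must have diameter \<open>\<infinity>\<close>.\<close>

definition ediameter :: "'a::metric_space set \<Rightarrow> ennreal" where
  "ediameter X = (SUP (s, t)\<in>X \<times> X. ennreal (dist s t))"

text \<open>Functions on \<open>[0, \<infinity>)\<close> are total functions \<open>real \<Rightarrow> real\<close> whose values at negative arguments
  are irrelevant. The image condition in \<open>class_G\<close> says that the inverse is defined on all
  of \<open>[0, \<infinity>)\<close>.\<close>

definition nonneg_inv :: "(real \<Rightarrow> real) \<Rightarrow> real \<Rightarrow> real" where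
  "nonneg_inv \<phi> = inv_into {0..} \<phi>"

definition class_G :: "real \<Rightarrow> real \<Rightarrow> (real \<Rightarrow> real) set" where
  "class_G a b = {\<phi>. strict_mono_on {0..} \<phi> \<and> continuous_on {0..} \<phi> \<and> \<phi> 0 = 0 \<and>
     \<phi> ` {0..} = {0..} \<and>
     (\<forall>x\<ge>0. \<forall>y\<ge>nonneg_inv \<phi> 1. x \<le> a + b * (\<phi> (x * y) / \<phi> y))}"

text \<open>The point \<open>\<epsilon> = 0\<close>, where the ball may be a null set, is left out of the domain of integration.\<close>

definition sigma_fn :: "(real \<Rightarrow> real) \<Rightarrow> 'a::metric_space measure \<Rightarrow> 'a \<Rightarrow> ennreal" where
  "sigma_fn \<phi> m x =
     (\<integral>\<^sup>+ \<epsilon>\<in>{\<epsilon>. 0 < \<epsilon> \<and> ennreal \<epsilon> \<le> ediameter (UNIV :: 'a set)}.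
        ennreal (nonneg_inv \<phi> (1 / measure m (cball x \<epsilon>))) \<partial>lborel)"

definition S_bar :: "(real \<Rightarrow> real) \<Rightarrow> 'a::metric_space measure \<Rightarrow> ennreal" where
  "S_bar \<phi> m = (\<integral>\<^sup>+ u. sigma_fn \<phi> m u \<partial>m)"

definition S_sup :: "(real \<Rightarrow> real) \<Rightarrow> 'a::metric_space measure \<Rightarrow> ennreal" where
  "S_sup \<phi> m = (SUP x. sigma_fn \<phi> m x)"

definition const_A :: "real \<Rightarrow> ennreal" where
  "const_A R = (if R = 2 then \<infinity> else ennreal (R ^ 3 / ((R - 1) * (R - 2))))"

definition const_B :: "real \<Rightarrow> ennreal" where
  "const_B R = ennreal (R\<^sup>2 / (R - 1))"

definition const_K ::
    "real \<Rightarrow> real \<Rightarrow> real \<Rightarrow> (real \<Rightarrow> real) \<Rightarrow> 'a::metric_space measure \<Rightarrow> ennreal" where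
  "const_K a b R \<phi> m = (ennreal a * const_A R + ennreal b * const_B R) * S_sup \<phi> m"

text \<open>On the diagonal the quotient is \<open>0 / 0 = 0\<close>.\<close>

definition phi_energy ::
    "(real \<Rightarrow> real) \<Rightarrow> ('a::metric_space \<times> 'a) measure \<Rightarrow> ('a \<Rightarrow> real) \<Rightarrow> ennreal" where
  "phi_energy \<phi> \<nu> f = (\<integral>\<^sup>+ (u, v). ennreal (\<phi> (\<bar>f u - f v\<bar> / dist u v)) \<partial>\<nu>)"

end

theory Submission
  imports Defs
begin

text \<open>
  Put \<open>y\<^sub>k = \<phi>\<^sup>-\<^sup>1(1) R\<^sup>k\<close>, let \<open>r\<^sub>k(x)\<close> be the least radius with
  \<open>m(B(x, r\<^sub>k(x))) \<ge> 1 / \<phi>(y\<^sub>k)\<close>, and let \<open>S\<^sub>k\<close> average over \<open>B(x, r\<^sub>k(x))\<close>, so that \<open>S\<^sub>0 f = \<integral> f dm\<close>.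
  The deviation of \<open>f\<close> from its mean is at most
  \<open>\<Sum>\<^sub>k S\<^sub>l \<dots> S\<^sub>k\<^sub>+\<^sub>1 E\<^sub>k\<close>, up to an error vanishing as \<open>l \<rightarrow> \<infinity>\<close>, where \<open>E\<^sub>k(x)\<close> is the mean of \<open>|f(x) - f(v)|\<close> over
  \<open>v \<in> B(x, r\<^sub>k(x))\<close>. The defining inequality of the class at \<open>y = y\<^sub>k\<^sub>+\<^sub>1\<close> bounds \<open>|f(x) - f(v)|\<close> by
  \<open>a y\<^sub>k\<^sub>+\<^sub>1 r\<^sub>k(x)\<close> plus a multiple of \<open>\<phi>(|f(x) - f(v)| / d(x, v))\<close>. The first part is controlled
  because \<open>r\<^sub>k\<close> is 1-Lipschitz and \<open>\<Sum>\<^sub>k y\<^sub>k\<^sub>+\<^sub>1 r\<^sub>k(x) \<le> B \<sigma>(x)\<close>; in the second,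
  \<open>S\<^sub>k\<^sub>+\<^sub>1 h \<le> \<phi>(y\<^sub>k\<^sub>+\<^sub>1) \<integral> h dm\<close> removes the dependence on the base point, and \<open>\<nu>\<close> is the normalised sum
  of the measures \<open>y\<^sub>k\<^sub>+\<^sub>1 r\<^sub>k(w) m(dw) m(dv | B(w, r\<^sub>k(w)))\<close>.

  For the inequality with \<open>\<psi>\<close>, apply the first one to \<open>f / \<lambda>\<close> with \<open>\<lambda> = |f(t) - \<integral> f dm| / K\<close>: the
  energy of \<open>f / \<lambda>\<close> must be at least 1, and integrating \<open>(\<psi>(\<lambda>) - \<alpha>) \<phi>(y) \<le> \<beta> \<phi>(\<lambda>y)\<close> concludes.
\<close>

section \<open>Probability measures with full support\<close>

text \<open>The boxes of balls of radius \<open>1 / Suc n\<close> centred in \<open>A\<close> and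
  \<open>B\<close> are countably many, and every open set of the product is the union of the boxes
  it contains. The dense sets stand in for second countability.\<close>

lemma sets_borel_prod_of_countable_dense:
  fixes A :: "'a::metric_space set" and B :: "'b::metric_space set"
  assumes A: "countable A" "closure A = UNIV" and B: "countable B" "closure B = UNIV"
  shows "sets ((borel :: 'a measure) \<Otimes>\<^sub>M (borel :: 'b measure)) = sets borel"
proof -
  have "sets ((borel :: 'a measure) \<Otimes>\<^sub>M (borel :: 'b measure)) \<subseteq> sets borel"
  proof -
    have "a \<times> b \<in> sets borel" if "a \<in> sets (borel::'a measure)" "b \<in> sets (borel::'b measure)" for a b
    proof -
      have "fst -` a \<inter> space borel \<in> sets (borel :: ('a \<times> 'b) measure)"
        by (rule measurable_sets[OF borel_measurable_continuous_onI that(1)]) (intro continuous_intros)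
      moreover have "snd -` b \<inter> space borel \<in> sets (borel :: ('a \<times> 'b) measure)"
        by (rule measurable_sets[OF borel_measurable_continuous_onI that(2)]) (intro continuous_intros)
      moreover have "a \<times> b = (fst -` a \<inter> space borel) \<inter> (snd -` b \<inter> space borel)" by auto
      ultimately show ?thesis by (metis sets.Int)
    qed
    then have "sigma_sets (space borel) {a \<times> b |a b. a \<in> sets (borel::'a measure) \<and> b \<in> sets (borel::'b measure)} \<subseteq> sets borel"
      by (intro sets.sigma_sets_subset) auto
    then show ?thesis by (simp add: sets_pair_measure)
  qed
  moreover have "sets borel \<subseteq> sets ((borel :: 'a measure) \<Otimes>\<^sub>M (borel :: 'b measure))"
  proof -
    have "U \<in> sets ((borel :: 'a measure) \<Otimes>\<^sub>M (borel :: 'b measure))" if U: "open U" for U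
    proof -
      define I where "I = {(x, y, n). x \<in> A \<and> y \<in> B \<and> ball x (1 / real (Suc n)) \<times> ball y (1 / real (Suc n)) \<subseteq> U}"
      have "I \<subseteq> A \<times> B \<times> UNIV" by (auto simp: I_def)
      then have cI: "countable I" by (rule countable_subset) (use A B in auto)
      have "U = (\<Union>(x, y, n)\<in>I. ball x (1 / real (Suc n)) \<times> ball y (1 / real (Suc n)))" (is "U = ?V")
      proof (intro equalityI subsetI)
        fix p assume "p \<in> U"
        obtain u v where p: "p = (u, v)" by (cases p)
        obtain P Q where PQ: "open P" "open Q" "u \<in> P" "v \<in> Q" "P \<times> Q \<subseteq> U"
          using U \<open>p \<in> U\<close> p by (auto elim!: open_prod_elim)
        obtain d where d: "d > 0" "ball u d \<subseteq> P" using PQ by (meson openE)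
        obtain e where e: "e > 0" "ball v e \<subseteq> Q" using PQ by (meson openE)
        \<comment> \<open>A ball whose centre lies within its radius of \<open>u\<close> stays
          inside the ball of twice that radius around \<open>u\<close>; hence the factor 2.\<close>
        obtain n where n: "1 / real (Suc n) < min d e / 2"
          using d(1) e(1) nat_approx_posE[of "min d e / 2"] by auto
        obtain x where x: "x \<in> A" "dist x u < 1 / real (Suc n)"
          using A(2) by (metis UNIV_I closure_approachable of_nat_0_less_iff zero_less_Suc zero_less_divide_1_iff)
        obtain y where y: "y \<in> B" "dist y v < 1 / real (Suc n)"
          using B(2) by (metis UNIV_I closure_approachable of_nat_0_less_iff zero_less_Suc zero_less_divide_1_iff)
        have "ball x (1 / real (Suc n)) \<subseteq> ball u d"
        proof
          fix z assume "z \<in> ball x (1 / real (Suc n))"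
          then show "z \<in> ball u d" using x(2) n dist_triangle[of u z x] by (auto simp: dist_commute)
        qed
        moreover have "ball y (1 / real (Suc n)) \<subseteq> ball v e"
        proof
          fix z assume "z \<in> ball y (1 / real (Suc n))"
          then show "z \<in> ball v e" using y(2) n dist_triangle[of v z y] by (auto simp: dist_commute)
        qed
        ultimately have "(x, y, n) \<in> I" using x y d e PQ unfolding I_def by blast
        then show "p \<in> ?V" using x y p by (force simp: dist_commute)
      qed (auto simp: I_def)
      moreover have "?V \<in> sets ((borel :: 'a measure) \<Otimes>\<^sub>M (borel :: 'b measure))"
        by (intro sets.countable_UN'[OF cI]) auto
      ultimately show ?thesis by simp
    qed
    then have "sigma_sets (space (borel \<Otimes>\<^sub>M borel)) {S. open S} \<subseteq> sets ((borel :: 'a measure) \<Otimes>\<^sub>M (borel :: 'b measure))"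
      by (intro sets.sigma_sets_subset) auto
    then show ?thesis
      by (simp add: borel_def[where 'a="'a \<times> 'b"] space_pair_measure)
  qed
  ultimately show ?thesis by blast
qed

locale full_support_prob = prob_space m for m :: "'a::metric_space measure" +
  assumes sets_borel: "sets m = sets borel"
    and support_UNIV: "msupport m = UNIV"
begin

lemma space_UNIV [simp]: "space m = UNIV"
  using sets_borel sets_eq_imp_space_eq by fastforce

lemma measurable_borel_iff: "borel_measurable m = borel_measurable borel"
  by (rule measurable_cong_sets) (auto simp: sets_borel)

lemma open_sets [intro, simp]: "open U \<Longrightarrow> U \<in> sets m"
  by (simp add: sets_borel)

lemma closed_sets [intro, simp]: "closed U \<Longrightarrow> U \<in> sets m"
  by (simp add: sets_borel)

lemma measure_open_pos: "open U \<Longrightarrow> x \<in> U \<Longrightarrow> 0 < measure m U"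
  using support_UNIV by (auto simp: msupport_def set_eq_iff emeasure_eq_measure)

lemma measure_cball_pos: "0 < e \<Longrightarrow> 0 < measure m (cball x e)"
  using measure_open_pos[OF open_ball, of x x e] finite_measure_mono[OF ball_subset_cball[of x e]]
  by simp

text \<open>The balls of radius \<open>e / 2\<close> around points of \<open>S\<close> are disjoint
  with positive mass, and finite sums of their masses are at most 1; a summable family of nonzero
  terms has a countable index set.\<close>

lemma countable_separated:
  fixes S :: "'a set"
  assumes "0 < e" and sep: "\<And>x y. x \<in> S \<Longrightarrow> y \<in> S \<Longrightarrow> x \<noteq> y \<Longrightarrow> e \<le> dist x y"
  shows "countable S"
proof -
  have disj: "disjoint_family_on (\<lambda>x. ball x (e / 2)) S"
    unfolding disjoint_family_on_def
  proof (intro ballI impI)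
    fix x y assume "x \<in> S" "y \<in> S" "x \<noteq> y"
    then have "e \<le> dist x y" by (rule sep)
    then show "ball x (e/2) \<inter> ball y (e/2) = {}" by (simp add: disjoint_ballI)
  qed
  have "(\<lambda>x. measure m (ball x (e / 2))) summable_on S"
  proof (rule nonneg_bdd_above_summable_on)
    show "bdd_above (sum (\<lambda>x. measure m (ball x (e / 2))) ` {F. F \<subseteq> S \<and> finite F})"
    proof (rule bdd_aboveI2)
      fix F assume "F \<in> {F. F \<subseteq> S \<and> finite F}"
      then have "finite F" "disjoint_family_on (\<lambda>x. ball x (e / 2)) F"
        using disj by (auto intro: disjoint_family_on_mono)
      then have "sum (\<lambda>x. measure m (ball x (e / 2))) F = measure m (\<Union>x\<in>F. ball x (e / 2))"
        by (subst finite_measure_finite_Union) auto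
      then show "sum (\<lambda>x. measure m (ball x (e / 2))) F \<le> 1" by simp
    qed
  qed simp
  then have "countable {x \<in> S. measure m (ball x (e / 2)) \<noteq> 0}"
    by (rule summable_countable_real)
  moreover have "measure m (ball x (e / 2)) \<noteq> 0" for x
    using measure_open_pos[of "ball x (e / 2)" x] \<open>0 < e\<close> by simp
  ultimately show ?thesis by simp
qed

text \<open>Zorn's lemma gives a maximal \<open>e\<close>-separated set; a point at distance at
  least \<open>e\<close> from all its members could be added to it.\<close>

lemma countable_net:
  assumes "0 < e"
  shows "\<exists>S :: 'a set. countable S \<and> (\<forall>x. \<exists>y\<in>S. dist y x < e)"
proof -
  define F where "F = {S :: 'a set. \<forall>x\<in>S. \<forall>y\<in>S. x \<noteq> y \<longrightarrow> e \<le> dist x y}"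
  have "\<exists>S\<in>F. \<forall>X\<in>F. S \<subseteq> X \<longrightarrow> X = S"
  proof (rule subset_Zorn')
    fix C assume "subset.chain F C"
    then have C: "C \<subseteq> F" "\<And>X Y. X \<in> C \<Longrightarrow> Y \<in> C \<Longrightarrow> X \<subseteq> Y \<or> Y \<subseteq> X"
      by (auto simp: subset_chain_def)
    show "\<Union>C \<in> F" unfolding F_def
    proof (intro CollectI ballI impI)
      fix x y assume "x \<in> \<Union>C" "y \<in> \<Union>C" "x \<noteq> y"
      then obtain X where "X \<in> C" "x \<in> X" "y \<in> X" using C(2) by blast
      then show "e \<le> dist x y" using C(1) \<open>x \<noteq> y\<close> unfolding F_def by blast
    qed
  qed
  then obtain S where S: "S \<in> F" and max: "\<And>X. X \<in> F \<Longrightarrow> S \<subseteq> X \<Longrightarrow> X = S" by blast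
  have "\<exists>y\<in>S. dist y x < e" for x
  proof (rule ccontr)
    assume *: "\<not> (\<exists>y\<in>S. dist y x < e)"
    then have "insert x S \<in> F" using S by (auto simp: F_def dist_commute not_less)
    then have "x \<in> S" using max by blast
    with * \<open>0 < e\<close> show False by auto
  qed
  moreover have "countable S" using S countable_separated[OF \<open>0 < e\<close>, of S] by (auto simp: F_def)
  ultimately show ?thesis by (intro exI[of _ S]) simp
qed

lemma countable_dense: "\<exists>A :: 'a set. countable A \<and> closure A = UNIV"
proof -
  have "\<forall>n. \<exists>S::'a set. countable S \<and> (\<forall>x. \<exists>y\<in>S. dist y x < 1 / real (Suc n))"
    by (intro allI countable_net) simp
  then obtain S where S: "\<And>n. countable (S n)" "\<And>n (x::'a). \<exists>y\<in>S n. dist y x < 1 / real (Suc n)"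
    by metis
  have "x \<in> closure (\<Union>n. S n)" for x
    unfolding closure_approachable
  proof (intro allI impI)
    fix e :: real assume "0 < e"
    then obtain n where "1 / real (Suc n) < e" using nat_approx_posE by blast
    with S(2)[of n x] show "\<exists>y\<in>\<Union>n. S n. dist y x < e" by force
  qed
  then show ?thesis using S(1) by (intro exI[of _ "\<Union>n. S n"]) auto
qed

text \<open>The space need not be second countable as a type, but full support forces it to be separable.\<close>

lemma sets_pair_borel: "sets (m \<Otimes>\<^sub>M m) = sets borel"
proof -
  have "sets (m \<Otimes>\<^sub>M m) = sets (borel \<Otimes>\<^sub>M borel)"
    by (rule sets_pair_measure_cong) (simp_all add: sets_borel)
  then show ?thesis using countable_dense sets_borel_prod_of_countable_dense by metis
qed

lemma borel_measurable_pair_continuous: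
  "continuous_on UNIV h \<Longrightarrow> h \<in> borel_measurable (m \<Otimes>\<^sub>M m)"
  using borel_measurable_continuous_onI measurable_cong_sets[OF sets_pair_borel refl] by blast

lemma measurable_dist [measurable]: "(\<lambda>p. dist (fst p) (snd p)) \<in> borel_measurable (m \<Otimes>\<^sub>M m)"
  by (rule borel_measurable_pair_continuous) (intro continuous_intros)

lemma measurable_continuous: "continuous_on UNIV f \<Longrightarrow> f \<in> borel_measurable m"
  by (simp add: measurable_borel_iff borel_measurable_continuous_onI)

text \<open>Otherwise the sets where \<open>f\<close> stays within half the gap of
  \<open>f x\<close> and of \<open>f y\<close> form a box of positive product mass on which the two
  coordinates have different values.\<close>

lemma continuous_AE_const:
  fixes f :: "'a \<Rightarrow> real"
  assumes f: "continuous_on UNIV f" and ae: "AE p in m \<Otimes>\<^sub>M m. f (fst p) = f (snd p)"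
  shows "f x = f y"
proof (rule ccontr)
  assume ne: "f x \<noteq> f y"
  define d where "d = \<bar>f x - f y\<bar> / 2"
  define U where "U = (\<lambda>z. {w. \<bar>f w - f z\<bar> < d})"
  have d: "0 < d" using ne by (simp add: d_def)
  have op: "open (U z)" for z unfolding U_def
    by (intro open_Collect_less continuous_intros f)
  have pos: "0 < measure m (U z)" for z
    by (rule measure_open_pos[OF op, of z]) (use d in \<open>simp add: U_def\<close>)
  have "AE p in m \<Otimes>\<^sub>M m. p \<notin> U x \<times> U y"
    using ae
  proof eventually_elim
    case (elim p)
    show ?case
    proof
      assume "p \<in> U x \<times> U y"
      then have "\<bar>f (fst p) - f x\<bar> < d" "\<bar>f (snd p) - f y\<bar> < d" by (auto simp: U_def)
      then show False using elim abs_triangle_ineq[of "f (fst p) - f x" "f y - f (snd p)"] unfolding d_def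
        by (simp add: abs_minus_commute)
    qed
  qed
  then have "emeasure (m \<Otimes>\<^sub>M m) (U x \<times> U y) = 0"
    using op by (subst (asm) AE_iff_measurable[where N="U x \<times> U y"]) (auto simp: space_pair_measure)
  moreover have "emeasure (m \<Otimes>\<^sub>M m) (U x \<times> U y) = emeasure m (U x) * emeasure m (U y)"
    by (rule emeasure_pair_measure_Times) (use op in auto)
  moreover have "measure m (U x) * measure m (U y) > 0" using pos by simp
  ultimately show False by (auto simp: emeasure_eq_measure ennreal_mult[symmetric])
qed

end

section \<open>The class of Young-type functions\<close>

lemma
  assumes "\<phi> \<in> class_G a b"
  shows class_G_strict_mono: "strict_mono_on {0..} \<phi>"
    and class_G_continuous: "continuous_on {0..} \<phi>"
    and class_G_zero: "\<phi> 0 = 0"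
    and class_G_image: "\<phi> ` {0..} = {0..}"
    and class_G_bound: "0 \<le> x \<Longrightarrow> nonneg_inv \<phi> 1 \<le> y \<Longrightarrow> x \<le> a + b * (\<phi> (x * y) / \<phi> y)"
  using assms by (auto simp: class_G_def)

lemma class_G_less_iff:
  assumes "\<phi> \<in> class_G a b" "0 \<le> x" "0 \<le> y"
  shows "\<phi> x < \<phi> y \<longleftrightarrow> x < y"
  using strict_mono_on_less[OF class_G_strict_mono[OF assms(1)]] assms by auto

lemma class_G_le_iff:
  assumes "\<phi> \<in> class_G a b" "0 \<le> x" "0 \<le> y"
  shows "\<phi> x \<le> \<phi> y \<longleftrightarrow> x \<le> y"
  using strict_mono_on_less_eq[OF class_G_strict_mono[OF assms(1)]] assms by auto

lemma class_G_nonneg: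
  assumes "\<phi> \<in> class_G a b" "0 \<le> x"
  shows "0 \<le> \<phi> x"
  using class_G_le_iff[OF assms(1), of 0 x] class_G_zero[OF assms(1)] assms(2) by simp

lemma
  assumes "\<phi> \<in> class_G a b" "0 \<le> z"
  shows class_G_inv_nonneg: "0 \<le> nonneg_inv \<phi> z"
    and class_G_phi_inv: "\<phi> (nonneg_inv \<phi> z) = z"
proof -
  have "z \<in> \<phi> ` {0..}" using class_G_image[OF assms(1)] assms(2) by simp
  then show "0 \<le> nonneg_inv \<phi> z" "\<phi> (nonneg_inv \<phi> z) = z"
    unfolding nonneg_inv_def using inv_into_into[of z \<phi> "{0..}"] by (auto simp: f_inv_into_f)
qed

lemma class_G_inv_less_iff:
  assumes "\<phi> \<in> class_G a b" "0 \<le> y" "0 \<le> z"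
  shows "y < nonneg_inv \<phi> z \<longleftrightarrow> \<phi> y < z"
  using class_G_less_iff[OF assms(1,2) class_G_inv_nonneg[OF assms(1,3)]]
    class_G_phi_inv[OF assms(1,3)] by simp

lemma class_G_inv_mono:
  assumes "\<phi> \<in> class_G a b" "0 \<le> y" "y \<le> z"
  shows "nonneg_inv \<phi> y \<le> nonneg_inv \<phi> z"
  using class_G_le_iff[OF assms(1) class_G_inv_nonneg[OF assms(1), of y] class_G_inv_nonneg[OF assms(1), of z]]
    class_G_phi_inv[OF assms(1)] assms by simp

lemma class_G_inv_one_pos:
  assumes "\<phi> \<in> class_G a b"
  shows "0 < nonneg_inv \<phi> 1"
  using class_G_inv_less_iff[OF assms, of 0 1] class_G_zero[OF assms] by simp

text \<open>For \<open>b = 0\<close> the defining inequality would bound every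
  \<open>x \<ge> 0\<close> by \<open>a\<close>.\<close>

lemma class_G_b_pos:
  assumes "\<phi> \<in> class_G a b" "0 \<le> a" "0 \<le> b"
  shows "0 < b"
  using class_G_bound[OF assms(1), of "a + 1" "nonneg_inv \<phi> 1"] assms(2,3)
  by (cases "b = 0") auto

lemma phi_energy_fst_snd:
  "phi_energy \<phi> \<nu> f = (\<integral>\<^sup>+ p. ennreal (\<phi> (\<bar>f (fst p) - f (snd p)\<bar> / dist (fst p) (snd p))) \<partial>\<nu>)"
  by (simp add: phi_energy_def case_prod_beta')

context full_support_prob
begin

lemma measurable_class_G_quotient:
  assumes "\<phi> \<in> class_G a b" and "continuous_on UNIV f"
  shows "(\<lambda>p. ennreal (\<phi> (\<bar>f (fst p) - f (snd p)\<bar> / dist (fst p) (snd p)))) \<in> borel_measurable (m \<Otimes>\<^sub>M m)"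
proof -
  \<comment> \<open>Values of \<open>\<phi>\<close> at negative arguments are arbitrary, so
    measurability is shown for a truncation that agrees with \<open>\<phi>\<close> on the
    nonnegative quotients.\<close>
  have "continuous_on UNIV (\<lambda>x. \<phi> (max 0 x))"
    by (rule continuous_on_compose2[OF class_G_continuous[OF assms(1)]]) (auto intro!: continuous_intros)
  then have [measurable]: "(\<lambda>x. \<phi> (max 0 x)) \<in> borel_measurable borel"
    by (rule borel_measurable_continuous_onI)
  have [measurable]: "f \<in> borel_measurable m" by (rule measurable_continuous[OF assms(2)])
  have "(\<lambda>p. ennreal (\<phi> (max 0 (\<bar>f (fst p) - f (snd p)\<bar> / dist (fst p) (snd p))))) \<in> borel_measurable (m \<Otimes>\<^sub>M m)"
    by measurable
  then show ?thesis by simp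
qed

text \<open>On \<open>{0..}\<close> the function \<open>\<phi>\<close> vanishes only at 0, so zero
  energy makes the increments vanish almost everywhere; on the diagonal they vanish anyway.\<close>

lemma phi_energy_product_eq_0:
  assumes "\<phi> \<in> class_G a b" and f: "continuous_on UNIV f" and "phi_energy \<phi> (m \<Otimes>\<^sub>M m) f = 0"
  shows "f x = f y"
proof (rule continuous_AE_const[OF f])
  have "AE p in m \<Otimes>\<^sub>M m. ennreal (\<phi> (\<bar>f (fst p) - f (snd p)\<bar> / dist (fst p) (snd p))) = 0"
    using assms(3) measurable_class_G_quotient[OF assms(1,2)]
    by (simp add: phi_energy_fst_snd nn_integral_0_iff_AE)
  then show "AE p in m \<Otimes>\<^sub>M m. f (fst p) = f (snd p)"
  proof eventually_elim
    case (elim p)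
    then have "\<not> 0 < \<phi> (\<bar>f (fst p) - f (snd p)\<bar> / dist (fst p) (snd p))"
      by (simp add: ennreal_eq_0_iff)
    then have "\<not> 0 < \<bar>f (fst p) - f (snd p)\<bar> / dist (fst p) (snd p)"
      using class_G_less_iff[OF assms(1), of 0] class_G_zero[OF assms(1)] by simp
    then show ?case by (auto simp: zero_less_divide_iff)
  qed
qed

text \<open>Balls have mass at most 1, so the integrand is at least
  \<open>nonneg_inv \<phi> 1\<close>. Hence \<open>sigma_fn\<close> is infinite on unbounded spaces
  and positive on spaces with two points.\<close>

lemma sigma_fn_ge:
  assumes "\<phi> \<in> class_G a b" "0 \<le> d" "ennreal d \<le> ediameter (UNIV :: 'a set)"
  shows "ennreal (nonneg_inv \<phi> 1 * d) \<le> sigma_fn \<phi> m x"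
proof -
  have "ennreal (nonneg_inv \<phi> 1 * d) = (\<integral>\<^sup>+ \<epsilon>. ennreal (nonneg_inv \<phi> 1) * indicator {0<..d} \<epsilon> \<partial>lborel)"
    using assms class_G_inv_one_pos[OF assms(1)]
    by (simp add: nn_integral_cmult_indicator ennreal_mult)
  also have "\<dots> \<le> sigma_fn \<phi> m x"
    unfolding sigma_fn_def
  proof (intro nn_integral_mono)
    fix \<epsilon>
    show "ennreal (nonneg_inv \<phi> 1) * indicator {0<..d} \<epsilon>
      \<le> ennreal (nonneg_inv \<phi> (1 / measure m (cball x \<epsilon>))) * indicator {\<epsilon>. 0 < \<epsilon> \<and> ennreal \<epsilon> \<le> ediameter (UNIV :: 'a set)} \<epsilon>"
    proof (cases "0 < \<epsilon> \<and> \<epsilon> \<le> d")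
      case True
      then have "ennreal \<epsilon> \<le> ediameter (UNIV :: 'a set)"
        using assms(3) by (meson ennreal_leI order_trans)
      moreover have "1 \<le> 1 / measure m (cball x \<epsilon>)"
        using True measure_cball_pos[of \<epsilon> x] by simp
      ultimately show ?thesis
        using True class_G_inv_mono[OF assms(1), of 1] by (simp add: ennreal_leI)
    qed auto
  qed
  finally show ?thesis .
qed

end

section \<open>Radii and averages\<close>

text \<open>The case of finite diameter: \<open>dist_le\<close> and \<open>D_le_ediameter\<close>
  together say that the real number \<open>D\<close> is the diameter.\<close>

locale chaining = full_support_prob m for m :: "'a::metric_space measure" +
  fixes \<phi> :: "real \<Rightarrow> real" and a b R D :: real
  assumes phi: "\<phi> \<in> class_G a b" and a_nonneg: "0 \<le> a" and b_nonneg: "0 \<le> b" and R_ge: "2 \<le> R"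
    and dist_le: "\<And>x y. dist x (y :: 'a) \<le> D"
    and D_le_ediameter: "ennreal D \<le> ediameter (UNIV :: 'a set)"
begin

definition lev :: "nat \<Rightarrow> real" where
  "lev k = nonneg_inv \<phi> 1 * R ^ k"

definition rad :: "nat \<Rightarrow> 'a \<Rightarrow> real" where
  "rad k x = Inf {e. 0 \<le> e \<and> 1 \<le> \<phi> (lev k) * measure m (cball x e)}"

lemma lev_pos: "0 < lev k"
  using class_G_inv_one_pos[OF phi] R_ge by (simp add: lev_def)

lemma lev_Suc: "lev (Suc k) = R * lev k"
  by (simp add: lev_def)

lemma lev_ge: "nonneg_inv \<phi> 1 \<le> lev k"
  using class_G_inv_one_pos[OF phi] R_ge by (simp add: lev_def)

lemma phi_lev_0: "\<phi> (lev 0) = 1"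
  by (simp add: lev_def class_G_phi_inv[OF phi])

lemma phi_lev_ge: "1 \<le> \<phi> (lev k)"
  using class_G_le_iff[OF phi class_G_inv_nonneg[OF phi], of 1 "lev k"] lev_ge[of k] lev_pos[of k]
  by (simp add: class_G_phi_inv[OF phi])

lemma D_nonneg: "0 \<le> D"
  using dist_le[of undefined undefined] by simp

lemma D_mem: "1 \<le> \<phi> (lev k) * measure m (cball x D)"
proof -
  have "cball x D = space m" using dist_le by auto
  then have "measure m (cball x D) = 1" using prob_space by simp
  then show ?thesis using phi_lev_ge by simp
qed

lemma rad_le: "0 \<le> e \<Longrightarrow> 1 \<le> \<phi> (lev k) * measure m (cball x e) \<Longrightarrow> rad k x \<le> e"
  unfolding rad_def by (rule cInf_lower) (auto intro: bdd_belowI[of _ 0])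

lemma rad_nonneg: "0 \<le> rad k x"
  unfolding rad_def by (rule cInf_greatest) (use D_mem D_nonneg in auto)

lemma rad_le_D: "rad k x \<le> D"
  by (rule rad_le[OF D_nonneg D_mem])

text \<open>The infimum is attained: the closed balls of radius \<open>rad k x + 1 / Suc n\<close>
  decrease to the one of radius \<open>rad k x\<close>, and \<open>m\<close> is continuous from
  above.\<close>

lemma measure_cball_rad: "1 \<le> \<phi> (lev k) * measure m (cball x (rad k x))"
proof -
  define A where "A n = cball x (rad k x + 1 / real (Suc n))" for n
  have ge: "1 \<le> \<phi> (lev k) * measure m (A n)" for n
  proof -
    have "Inf {e. 0 \<le> e \<and> 1 \<le> \<phi> (lev k) * measure m (cball x e)} < rad k x + 1 / real (Suc n)"
      by (simp flip: rad_def)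
    then obtain e where e: "1 \<le> \<phi> (lev k) * measure m (cball x e)" "e < rad k x + 1 / real (Suc n)"
      using D_mem[of k x] D_nonneg by (subst (asm) cInf_less_iff) (auto intro: bdd_belowI[of _ 0])
    have "measure m (cball x e) \<le> measure m (A n)"
      unfolding A_def using e(2) by (intro finite_measure_mono subset_cball) auto
    then show ?thesis using e(1) phi_lev_ge[of k] mult_left_mono[of "measure m (cball x e)" "measure m (A n)" "\<phi> (lev k)"]
      by linarith
  qed
  have "decseq A"
    unfolding A_def by (intro decseq_SucI subset_cball) (simp add: field_simps)
  moreover have "(\<Inter>n. A n) = cball x (rad k x)"
  proof (intro equalityI subsetI)
    fix y assume y: "y \<in> (\<Inter>n. A n)"
    show "y \<in> cball x (rad k x)"
    proof (rule ccontr)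
      assume "y \<notin> cball x (rad k x)"
      then have "0 < dist x y - rad k x" by simp
      then obtain n where "1 / real (Suc n) < dist x y - rad k x" using nat_approx_posE by blast
      moreover have "dist x y \<le> rad k x + 1 / real (Suc n)" using y by (auto simp: A_def)
      ultimately show False by linarith
    qed
  next
    fix y assume "y \<in> cball x (rad k x)"
    then have "dist x y \<le> rad k x + 1 / real (Suc n)" for n
      using add_increasing2[of "1 / real (Suc n)" "dist x y" "rad k x"] by simp
    then show "y \<in> (\<Inter>n. A n)" by (simp add: A_def)
  qed
  ultimately have "(\<lambda>n. measure m (A n)) \<longlonglongrightarrow> measure m (cball x (rad k x))"
    using finite_Lim_measure_decseq[of A] by (auto simp: A_def)
  then have "(\<lambda>n. \<phi> (lev k) * measure m (A n)) \<longlonglongrightarrow> \<phi> (lev k) * measure m (cball x (rad k x))"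
    by (intro tendsto_intros)
  then show ?thesis by (rule LIMSEQ_le_const) (use ge in auto)
qed

lemma emeasure_cball_rad_pos: "emeasure m (cball x (rad k x)) \<noteq> 0"
  using measure_cball_rad[of k x] by (auto simp: emeasure_eq_measure)

text \<open>Below the critical radius the ball has mass less than \<open>1 / \<phi> (lev k)\<close>.
  This links the radii to the integrand of \<open>sigma_fn\<close>.\<close>

lemma less_rad:
  assumes "0 < e" "e < rad k x"
  shows "lev k < nonneg_inv \<phi> (1 / measure m (cball x e))"
proof -
  have "\<phi> (lev k) * measure m (cball x e) < 1"
    using rad_le[of e k x] assms by linarith
  then have "\<phi> (lev k) < 1 / measure m (cball x e)"
    using measure_cball_pos[OF assms(1)] by (simp add: field_simps)
  then show ?thesis using class_G_inv_less_iff[OF phi, of "lev k"] lev_pos[of k] by simp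
qed

text \<open>The enlarged ball around \<open>x\<close> contains the ball of radius
  \<open>rad k z\<close> around \<open>z\<close>, which is already heavy enough.\<close>

lemma rad_lipschitz: "rad k x \<le> rad k z + dist z x"
proof (rule rad_le)
  have "cball z (rad k z) \<subseteq> cball x (rad k z + dist z x)"
  proof
    fix y assume "y \<in> cball z (rad k z)"
    then show "y \<in> cball x (rad k z + dist z x)"
      using dist_triangle[of x y z] by (simp add: dist_commute)
  qed
  then have "measure m (cball z (rad k z)) \<le> measure m (cball x (rad k z + dist z x))"
    by (intro finite_measure_mono) auto
  then have "\<phi> (lev k) * measure m (cball z (rad k z)) \<le> \<phi> (lev k) * measure m (cball x (rad k z + dist z x))"
    using phi_lev_ge[of k] by (intro mult_left_mono) auto
  then show "1 \<le> \<phi> (lev k) * measure m (cball x (rad k z + dist z x))"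
    using measure_cball_rad[of k z] by linarith
qed (use rad_nonneg in simp)

lemma measurable_rad [measurable]: "rad k \<in> borel_measurable m"
proof -
  have "\<bar>rad k x - rad k y\<bar> \<le> dist x y" for x y
    using rad_lipschitz[of k x y] rad_lipschitz[of k y x] by (simp add: dist_commute abs_le_iff)
  then have "continuous_on UNIV (rad k)"
    by (intro lipschitz_on_continuous_on[of 1]) (auto intro!: lipschitz_onI simp: dist_real_def)
  then show ?thesis by (rule measurable_continuous)
qed

text \<open>By full support the ball of radius \<open>e\<close> has mass \<open>p > 0\<close>, and
  the levels eventually pass \<open>nonneg_inv \<phi> (1 / p)\<close>.\<close>

lemma ex_rad_le:
  assumes "0 < e"
  shows "\<exists>k. rad k x \<le> e"
proof -
  define p where "p = measure m (cball x e)"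
  have p: "0 < p" unfolding p_def by (rule measure_cball_pos[OF assms])
  obtain k where "nonneg_inv \<phi> (1 / p) / nonneg_inv \<phi> 1 < R ^ k"
    using real_arch_pow[of R] R_ge by auto
  then have "nonneg_inv \<phi> (1 / p) \<le> lev k"
    using class_G_inv_one_pos[OF phi] by (simp add: lev_def field_simps)
  then have "1 / p \<le> \<phi> (lev k)"
    using class_G_le_iff[OF phi class_G_inv_nonneg[OF phi, of "1 / p"], of "lev k"] p lev_pos[of k]
    by (simp add: class_G_phi_inv[OF phi])
  then have "1 \<le> \<phi> (lev k) * p" using p by (simp add: field_simps)
  then show ?thesis using rad_le[of e k x] assms unfolding p_def by auto
qed

section \<open>The averaging operators\<close>

definition ker :: "nat \<Rightarrow> 'a \<Rightarrow> 'a \<Rightarrow> ennreal" where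
  "ker k x v = indicator (cball x (rad k x)) v / emeasure m (cball x (rad k x))"

definition avg :: "nat \<Rightarrow> ('a \<Rightarrow> ennreal) \<Rightarrow> 'a \<Rightarrow> ennreal" where
  "avg k g x = (\<integral>\<^sup>+ v. g v * ker k x v \<partial>m)"

text \<open>The ball indicator is that of a measurable set of pairs; integrating its sections shows
  that the normalising mass is measurable in the base point.\<close>

lemma measurable_ker: "(\<lambda>p. ker k (fst p) (snd p)) \<in> borel_measurable (m \<Otimes>\<^sub>M m)"
proof -
  have ind: "(\<lambda>p. indicator (cball (fst p) (rad k (fst p))) (snd p) :: ennreal) \<in> borel_measurable (m \<Otimes>\<^sub>M m)"
  proof -
    have "{p \<in> space (m \<Otimes>\<^sub>M m). dist (fst p) (snd p) \<le> rad k (fst p)} \<in> sets (m \<Otimes>\<^sub>M m)"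
      by measurable
    then have "(indicator {p \<in> space (m \<Otimes>\<^sub>M m). dist (fst p) (snd p) \<le> rad k (fst p)} :: _ \<Rightarrow> ennreal)
        \<in> borel_measurable (m \<Otimes>\<^sub>M m)"
      by simp
    also have "indicator {p \<in> space (m \<Otimes>\<^sub>M m). dist (fst p) (snd p) \<le> rad k (fst p)} =
        (\<lambda>p. indicator (cball (fst p) (rad k (fst p))) (snd p) :: ennreal)"
      by (auto simp: indicator_def space_pair_measure fun_eq_iff)
    finally show ?thesis .
  qed
  have "(\<lambda>x. \<integral>\<^sup>+ v. indicator (cball x (rad k x)) v \<partial>m) \<in> borel_measurable m"
    using ind by (intro borel_measurable_nn_integral) (simp add: case_prod_beta')
  then have [measurable]: "(\<lambda>x. emeasure m (cball x (rad k x))) \<in> borel_measurable m" by simp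
  show ?thesis unfolding ker_def
    by (intro borel_measurable_divide_ennreal ind) measurable
qed

lemma measurable_ker_section [measurable]: "ker k x \<in> borel_measurable m"
  unfolding ker_def by (intro borel_measurable_divide_ennreal borel_measurable_indicator) auto

lemma measurable_avg:
  assumes "(\<lambda>p. g (fst p) (snd p)) \<in> borel_measurable (m \<Otimes>\<^sub>M m)"
  shows "(\<lambda>x. avg k (g x) x) \<in> borel_measurable m"
  unfolding avg_def using assms measurable_ker[of k]
  by (intro borel_measurable_nn_integral) (simp add: case_prod_beta')

lemma ker_integral: "(\<integral>\<^sup>+ v. ker k x v \<partial>m) = 1"
  unfolding ker_def using emeasure_cball_rad_pos[of x k]
  by (subst nn_integral_divide) (auto intro!: ennreal_divide_self borel_measurable_indicator simp: emeasure_eq_measure)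

lemma ker_le: "ker k x v \<le> ennreal (\<phi> (lev k))"
proof -
  let ?p = "measure m (cball x (rad k x))"
  have p: "0 < ?p" using measure_cball_rad[of k x] by (cases "?p = 0") (auto simp: less_le)
  have "ker k x v \<le> 1 / emeasure m (cball x (rad k x))"
    unfolding ker_def by (rule divide_right_mono_ennreal) (simp add: indicator_def)
  also have "\<dots> = ennreal (1 / ?p)"
    using p by (simp add: emeasure_eq_measure divide_ennreal flip: ennreal_1)
  also have "1 / ?p \<le> \<phi> (lev k)"
    using measure_cball_rad[of k x] p by (simp add: field_simps)
  finally show ?thesis by (simp add: ennreal_leI)
qed

lemma avg_mono:
  assumes "\<And>v. dist x v \<le> rad k x \<Longrightarrow> g v \<le> h v"
  shows "avg k g x \<le> avg k h x"
  unfolding avg_def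
proof (intro nn_integral_mono)
  fix v
  show "g v * ker k x v \<le> h v * ker k x v"
    using assms[of v] by (cases "dist x v \<le> rad k x") (auto simp: ker_def intro: mult_right_mono)
qed

lemma avg_const: "avg k (\<lambda>_. c) x = c"
  unfolding avg_def by (subst nn_integral_cmult) (auto simp: ker_integral)

lemma avg_add:
  assumes [measurable]: "g \<in> borel_measurable m" "h \<in> borel_measurable m"
  shows "avg k (\<lambda>v. g v + h v) x = avg k g x + avg k h x"
  unfolding avg_def by (subst nn_integral_add[symmetric]) (auto simp: distrib_right)

lemma avg_cmult:
  assumes [measurable]: "g \<in> borel_measurable m"
  shows "avg k (\<lambda>v. c * g v) x = c * avg k g x"
  unfolding avg_def by (subst nn_integral_cmult[symmetric]) (auto simp: mult.assoc)

text \<open>The kernel bound \<open>ker_le\<close> is uniform in the base point. Its factor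
  \<open>\<phi> (lev k)\<close> is cancelled later by the denominator from
  \<open>increment_le\<close>.\<close>

lemma avg_le_integral:
  assumes [measurable]: "g \<in> borel_measurable m"
  shows "avg k g x \<le> ennreal (\<phi> (lev k)) * (\<integral>\<^sup>+ v. g v \<partial>m)"
proof -
  have "avg k g x \<le> (\<integral>\<^sup>+ v. ennreal (\<phi> (lev k)) * g v \<partial>m)"
    unfolding avg_def
    by (intro nn_integral_mono) (metis ker_le mult.commute mult_left_mono zero_le)
  then show ?thesis by (simp add: nn_integral_cmult)
qed

text \<open>Since \<open>\<phi> (lev 0) = 1\<close>, the ball of radius \<open>rad 0 x\<close> has
  full mass, and averaging over it is integration against \<open>m\<close>.\<close>

lemma integral_le_avg_0:
  assumes [measurable]: "g \<in> borel_measurable m"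
  shows "(\<integral>\<^sup>+ v. g v \<partial>m) \<le> avg 0 g x"
proof -
  have one: "measure m (cball x (rad 0 x)) = 1"
    using measure_cball_rad[of 0 x] phi_lev_0 prob_le_1[of "cball x (rad 0 x)"] by simp
  then have "AE v in m. v \<in> cball x (rad 0 x)"
    by (subst AE_in_set_eq_1) auto
  then have "(\<integral>\<^sup>+ v. g v \<partial>m) = avg 0 g x"
    unfolding avg_def
    by (intro nn_integral_cong_AE) (auto simp: ker_def emeasure_eq_measure one)
  then show ?thesis by simp
qed

section \<open>Oscillation and local energy\<close>

definition osc :: "nat \<Rightarrow> ('a \<Rightarrow> real) \<Rightarrow> 'a \<Rightarrow> ennreal" where
  "osc k f x = avg k (\<lambda>v. ennreal \<bar>f x - f v\<bar>) x"

text \<open>The weight is the one that occurs in \<open>dens\<close>, so that the integrals over all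
  \<open>k\<close> add up to the unnormalised energy.\<close>

definition loc_energy :: "nat \<Rightarrow> ('a \<Rightarrow> real) \<Rightarrow> 'a \<Rightarrow> ennreal" where
  "loc_energy k f x = ennreal (lev (Suc k) * rad k x) *
     avg k (\<lambda>v. ennreal (\<phi> (\<bar>f x - f v\<bar> / dist x v))) x"

lemma measurable_quotient_section:
  assumes "continuous_on UNIV f"
  shows "(\<lambda>v. ennreal (\<phi> (\<bar>f x - f v\<bar> / dist x v))) \<in> borel_measurable m"
  using measurable_Pair2[OF measurable_class_G_quotient[OF phi assms], of x] by simp

lemma measurable_loc_energy:
  assumes "continuous_on UNIV f"
  shows "loc_energy k f \<in> borel_measurable m"
proof -
  have [measurable]: "(\<lambda>x. avg k (\<lambda>v. ennreal (\<phi> (\<bar>f x - f v\<bar> / dist x v))) x) \<in> borel_measurable m"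
    by (rule measurable_avg) (rule measurable_class_G_quotient[OF phi assms])
  show ?thesis unfolding loc_energy_def by measurable
qed

text \<open>The class inequality is used at level \<open>Suc k\<close> for the radius of index
  \<open>k\<close>: its denominator \<open>\<phi> (lev (Suc k))\<close> is what a later average of
  index \<open>Suc k\<close> costs.\<close>

lemma increment_le:
  assumes "dist x v \<le> rad k x"
  shows "\<bar>f x - f v\<bar> \<le> a * (lev (Suc k) * rad k x) +
    b / \<phi> (lev (Suc k)) * (lev (Suc k) * rad k x) * \<phi> (\<bar>f x - f v\<bar> / dist x v)"
proof -
  define q where "q = \<bar>f x - f v\<bar> / dist x v"
  define y where "y = lev (Suc k)"
  have q: "0 \<le> q" and y: "0 < y" by (auto simp: q_def y_def lev_pos)
  have fy: "0 < \<phi> y" using phi_lev_ge[of "Suc k"] by (simp add: y_def)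
  have fq: "0 \<le> \<phi> q" by (rule class_G_nonneg[OF phi q])
  \<comment> \<open>With \<open>q / y\<close> as the first argument, the product inside
    \<open>\<phi>\<close> is \<open>q\<close> itself.\<close>
  have "q / y \<le> a + b * (\<phi> (q / y * y) / \<phi> y)"
    using class_G_bound[OF phi, of "q / y" y] q y lev_ge[of "Suc k"] by (simp add: y_def)
  then have *: "q / y \<le> a + b * (\<phi> q / \<phi> y)" using y by simp
  have nn: "0 \<le> a + b * (\<phi> q / \<phi> y)" using a_nonneg b_nonneg fq fy by simp
  have "\<bar>f x - f v\<bar> = dist x v * y * (q / y)" using y by (cases "x = v") (auto simp: q_def)
  also have "\<dots> \<le> rad k x * y * (a + b * (\<phi> q / \<phi> y))"
    using * assms y q nn by (intro mult_mono) (auto simp: rad_nonneg)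
  also have "\<dots> = a * (y * rad k x) + b / \<phi> y * (y * rad k x) * \<phi> q"
    by (simp add: algebra_simps)
  finally show ?thesis by (simp add: q_def y_def)
qed

lemma osc_le:
  assumes f: "continuous_on UNIV f"
  shows "osc k f x \<le> ennreal (a * (lev (Suc k) * rad k x)) + ennreal (b / \<phi> (lev (Suc k))) * loc_energy k f x"
proof -
  define s where "s = lev (Suc k) * rad k x"
  define c where "c = b / \<phi> (lev (Suc k))"
  have s: "0 \<le> s" using lev_pos[of "Suc k"] rad_nonneg[of k x] by (simp add: s_def)
  have c: "0 \<le> c" using b_nonneg phi_lev_ge[of "Suc k"] by (simp add: c_def)
  have [measurable]: "(\<lambda>v. ennreal (\<phi> (\<bar>f x - f v\<bar> / dist x v))) \<in> borel_measurable m"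
    by (rule measurable_quotient_section[OF f])
  have "osc k f x \<le> avg k (\<lambda>v. ennreal (a * s) + ennreal (c * s) * ennreal (\<phi> (\<bar>f x - f v\<bar> / dist x v))) x"
    unfolding osc_def
  proof (rule avg_mono)
    fix v assume "dist x v \<le> rad k x"
    have "0 \<le> \<phi> (\<bar>f x - f v\<bar> / dist x v)" by (rule class_G_nonneg[OF phi]) simp
    then show "ennreal \<bar>f x - f v\<bar> \<le> ennreal (a * s) + ennreal (c * s) * ennreal (\<phi> (\<bar>f x - f v\<bar> / dist x v))"
      using increment_le[OF \<open>dist x v \<le> rad k x\<close>, of f] s c a_nonneg
      by (simp add: s_def[symmetric] c_def[symmetric] flip: ennreal_mult ennreal_plus)
  qed
  also have "\<dots> = ennreal (a * s) + ennreal c * loc_energy k f x"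
    using s c by (simp add: avg_add avg_const avg_cmult loc_energy_def s_def[symmetric] ennreal_mult mult.assoc)
  finally show ?thesis by (simp add: s_def c_def)
qed

section \<open>Geometric weights and the chaining induction\<close>

lemma sum_lev_le: "(R - 1) * (\<Sum>j<n. lev (Suc j)) \<le> lev (Suc n)"
proof (induction n)
  case 0
  show ?case using lev_pos[of "Suc 0"] by simp
next
  case (Suc n)
  \<comment> \<open>The bound reproduces itself:
    \<open>lev (Suc n) + (R - 1) * lev (Suc n) = R * lev (Suc n)\<close>.\<close>
  then show ?case by (simp add: lev_Suc[of "Suc n"] algebra_simps)
qed

definition rad_sum :: "nat \<Rightarrow> 'a \<Rightarrow> real" where
  "rad_sum n x = (\<Sum>j<n. lev (Suc j) * rad j x)"

lemma rad_sum_nonneg: "0 \<le> rad_sum n x"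
  using lev_pos rad_nonneg by (auto simp: rad_sum_def less_imp_le intro!: sum_nonneg)

text \<open>The invariant of the chaining induction: \<open>S\<^sub>l\<^sub>+\<^sub>1 r\<^sub>j \<le> r\<^sub>j + r\<^sub>l\<^sub>+\<^sub>1\<close> doubles the total weight at each
  step, which the growth rate \<open>R > 2\<close> of the levels absorbs. For \<open>R = 2\<close> the value is junk, but then
  it is only used with \<open>a = 0\<close>.\<close>

definition chain_bound :: "nat \<Rightarrow> 'a \<Rightarrow> real" where
  "chain_bound l x = (R - 1) / (R - 2) * rad_sum l x + 1 / (R - 2) * (lev (Suc l) * rad l x)"

lemma chain_bound_nonneg: "0 \<le> chain_bound l x"
  using R_ge rad_sum_nonneg[of l x] lev_pos[of "Suc l"] rad_nonneg[of l x] by (simp add: chain_bound_def)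

text \<open>As \<open>(R - 1) / (R - 2) = 1 + 1 / (R - 2)\<close>, the left side is a multiple of
  \<open>rad_sum (Suc l) v\<close>. Passing from \<open>v\<close> to \<open>x\<close> costs
  \<open>rad (Suc l) x\<close> per radius, and the geometric sum of the levels turns this into the
  last term of \<open>chain_bound (Suc l) x\<close>.\<close>

lemma chain_bound_step:
  assumes "2 < R" and v: "dist x v \<le> rad (Suc l) x"
  shows "lev (Suc l) * rad l v + chain_bound l v \<le> chain_bound (Suc l) x"
proof -
  have "rad_sum (Suc l) v \<le> (\<Sum>j<Suc l. lev (Suc j) * (rad j x + rad (Suc l) x))"
    unfolding rad_sum_def
  proof (intro sum_mono mult_left_mono)
    fix j show "rad j v \<le> rad j x + rad (Suc l) x"
      using rad_lipschitz[of j v x] v by linarith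
  qed (use lev_pos in \<open>auto intro: less_imp_le\<close>)
  also have "\<dots> = rad_sum (Suc l) x + rad (Suc l) x * (\<Sum>j<Suc l. lev (Suc j))"
    by (simp add: rad_sum_def distrib_left sum.distrib sum_distrib_left mult.commute)
  also have "(\<Sum>j<Suc l. lev (Suc j)) \<le> lev (Suc (Suc l)) / (R - 1)"
    using sum_lev_le[of "Suc l"] assms by (simp add: field_simps)
  finally have "rad_sum (Suc l) v \<le> rad_sum (Suc l) x + rad (Suc l) x * (lev (Suc (Suc l)) / (R - 1))"
    using rad_nonneg[of "Suc l" x] by (auto intro: mult_left_mono)
  then have "(R - 1) / (R - 2) * rad_sum (Suc l) v \<le>
     (R - 1) / (R - 2) * (rad_sum (Suc l) x + rad (Suc l) x * (lev (Suc (Suc l)) / (R - 1)))"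
    using assms by (intro mult_left_mono) auto
  also have "\<dots> = chain_bound (Suc l) x"
    using assms by (simp add: chain_bound_def distrib_left)
  also have "(R - 1) / (R - 2) * rad_sum (Suc l) v = lev (Suc l) * rad l v + chain_bound l v"
  proof -
    have "(R - 1) / (R - 2) = 1 + 1 / (R - 2)" using assms by (simp add: field_simps)
    then have "(R - 1) / (R - 2) * (lev (Suc l) * rad l v) =
        lev (Suc l) * rad l v + 1 / (R - 2) * (lev (Suc l) * rad l v)"
      by (metis distrib_right mult_1)
    then show ?thesis by (simp add: chain_bound_def rad_sum_def distrib_left)
  qed
  finally show ?thesis .
qed

text \<open>Induction on \<open>l\<close>, for all points at once. The step averages the bound at
  \<open>v\<close> over the ball of radius \<open>rad (Suc l) x\<close>; \<open>osc_le\<close>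
  splits \<open>osc l f v\<close> into a part absorbed by \<open>chain_bound\<close> and a local
  energy.\<close>

lemma deviation_le:
  fixes f :: "'a \<Rightarrow> real"
  assumes f: "continuous_on UNIV f" "bounded (range f)" and aR: "a = 0 \<or> 2 < R"
  shows "ennreal \<bar>f x - (LINT u|m. f u)\<bar> \<le>
    osc l f x + (ennreal (a * chain_bound l x) + ennreal b * (\<Sum>k<l. \<integral>\<^sup>+ w. loc_energy k f w \<partial>m))"
proof (induction l arbitrary: x)
  case 0
  have [measurable]: "f \<in> borel_measurable m" by (rule measurable_continuous[OF f(1)])
  obtain C where C: "\<And>u. \<bar>f u\<bar> \<le> C" using f(2) by (auto simp: bounded_iff)
  have int: "integrable m f"
    by (rule integrable_const_bound[where B=C]) (auto simp: C)
  have eq: "f x - (LINT u|m. f u) = (LINT u|m. f x - f u)"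
    using int prob_space by simp
  have "ennreal (norm (LINT u|m. f x - f u)) \<le> (\<integral>\<^sup>+ u. ennreal (norm (f x - f u)) \<partial>m)"
    using int by (intro integral_norm_bound_ennreal) simp
  then have "ennreal \<bar>f x - (LINT u|m. f u)\<bar> \<le> (\<integral>\<^sup>+ u. ennreal \<bar>f x - f u\<bar> \<partial>m)"
    unfolding eq real_norm_def .
  also have "\<dots> \<le> osc 0 f x" unfolding osc_def by (rule integral_le_avg_0) measurable
  finally show ?case by (simp add: add_increasing2)
next
  case (Suc l)
  define c where "c = (LINT u|m. f u)"
  define E where "E = (\<Sum>k<l. \<integral>\<^sup>+ w. loc_energy k f w \<partial>m)"
  define q where "q = b / \<phi> (lev (Suc l))"
  have [measurable]: "f \<in> borel_measurable m" by (rule measurable_continuous[OF f(1)])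
  have [measurable]: "loc_energy l f \<in> borel_measurable m" by (rule measurable_loc_energy[OF f(1)])
  have q: "0 \<le> q" using b_nonneg phi_lev_ge[of "Suc l"] by (simp add: q_def)
  have "ennreal \<bar>f x - c\<bar> = avg (Suc l) (\<lambda>_. ennreal \<bar>f x - c\<bar>) x"
    by (simp add: avg_const)
  also have "\<dots> \<le> avg (Suc l) (\<lambda>v. ennreal \<bar>f x - f v\<bar> + ennreal \<bar>f v - c\<bar>) x"
    by (rule avg_mono) (simp flip: ennreal_plus)
  also have "\<dots> = osc (Suc l) f x + avg (Suc l) (\<lambda>v. ennreal \<bar>f v - c\<bar>) x"
    unfolding osc_def by (rule avg_add) measurable
  also have "avg (Suc l) (\<lambda>v. ennreal \<bar>f v - c\<bar>) x \<le>
      avg (Suc l) (\<lambda>v. (ennreal (a * chain_bound (Suc l) x) + ennreal b * E) + ennreal q * loc_energy l f v) x"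
  proof (rule avg_mono)
    fix v assume v: "dist x v \<le> rad (Suc l) x"
    let ?s = "lev (Suc l) * rad l v"
    have s: "0 \<le> ?s" using lev_pos[of "Suc l"] rad_nonneg[of l v] by simp
    have aU: "ennreal (a * ?s) + ennreal (a * chain_bound l v) \<le> ennreal (a * chain_bound (Suc l) x)"
    proof (cases "a = 0")
      case False
      then have "?s + chain_bound l v \<le> chain_bound (Suc l) x" using chain_bound_step[OF _ v] aR by simp
      then have "a * (?s + chain_bound l v) \<le> a * chain_bound (Suc l) x" using a_nonneg by (rule mult_left_mono)
      then show ?thesis
        using s a_nonneg chain_bound_nonneg[of l v] by (simp add: distrib_left ennreal_leI flip: ennreal_plus)
    qed simp
    have "ennreal \<bar>f v - c\<bar> \<le> osc l f v + (ennreal (a * chain_bound l v) + ennreal b * E)"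
      using Suc.IH[of v] by (simp add: c_def E_def)
    also have "\<dots> \<le> (ennreal (a * ?s) + ennreal q * loc_energy l f v) + (ennreal (a * chain_bound l v) + ennreal b * E)"
      using osc_le[OF f(1), of l v] by (intro add_right_mono) (simp add: q_def)
    also have "\<dots> = (ennreal (a * ?s) + ennreal (a * chain_bound l v)) + (ennreal b * E + ennreal q * loc_energy l f v)"
      by (simp add: ac_simps)
    also have "\<dots> \<le> ennreal (a * chain_bound (Suc l) x) + (ennreal b * E + ennreal q * loc_energy l f v)"
      using aU by (rule add_right_mono)
    finally show "ennreal \<bar>f v - c\<bar> \<le> (ennreal (a * chain_bound (Suc l) x) + ennreal b * E) + ennreal q * loc_energy l f v"
      by (simp add: ac_simps)
  qed
  also have "avg (Suc l) (\<lambda>v. (ennreal (a * chain_bound (Suc l) x) + ennreal b * E) + ennreal q * loc_energy l f v) x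
      = (ennreal (a * chain_bound (Suc l) x) + ennreal b * E) + ennreal q * avg (Suc l) (loc_energy l f) x"
    by (subst avg_add) (auto simp: avg_const avg_cmult)
  \<comment> \<open>The average around \<open>x\<close> becomes an integral over the whole space,
    and the factor \<open>\<phi> (lev (Suc l))\<close> cancels the denominator of
    \<open>q\<close>.\<close>
  also have "ennreal q * avg (Suc l) (loc_energy l f) x \<le>
      ennreal q * (ennreal (\<phi> (lev (Suc l))) * (\<integral>\<^sup>+ w. loc_energy l f w \<partial>m))"
    by (intro mult_left_mono avg_le_integral) auto
  also have "\<dots> = ennreal b * (\<integral>\<^sup>+ w. loc_energy l f w \<partial>m)"
    using q phi_lev_ge[of "Suc l"] by (simp add: mult.assoc[symmetric] q_def flip: ennreal_mult)
  finally show ?case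
    by (simp add: c_def E_def distrib_left ac_simps add_mono)
qed

section \<open>Passage to the limit and comparison with \<open>sigma_fn\<close>\<close>

lemma osc_small:
  assumes f: "continuous_on UNIV f" and "0 < e"
  shows "\<exists>l. osc l f x \<le> ennreal e"
proof -
  obtain d where d: "0 < d" "\<And>v. dist v x < d \<Longrightarrow> dist (f v) (f x) < e"
    using f \<open>0 < e\<close> unfolding continuous_on_iff by (metis UNIV_I)
  \<comment> \<open>Half of \<open>d\<close> keeps the closed ball inside the open ball on which
    \<open>f\<close> varies by less than \<open>e\<close>.\<close>
  obtain l where l: "rad l x \<le> d / 2" using ex_rad_le[of "d / 2" x] d(1) by auto
  have "osc l f x \<le> avg l (\<lambda>_. ennreal e) x"
    unfolding osc_def
  proof (intro avg_mono ennreal_leI)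
    fix v assume "dist x v \<le> rad l x"
    then show "\<bar>f x - f v\<bar> \<le> e"
      using d(2)[of v] l d(1) by (simp add: dist_commute dist_real_def abs_minus_commute)
  qed
  then show ?thesis by (auto simp: avg_const)
qed

text \<open>Each \<open>rad k x\<close> is the length of the interval where
  \<open>e < rad k x\<close>. At a fixed \<open>e\<close>, if \<open>n\<close> is the last index
  with \<open>e < rad n x\<close>, the weights up to \<open>n\<close> sum to at most
  \<open>lev n\<close>, which lies below the integrand by \<open>less_rad\<close>.\<close>

lemma rad_sum_le_sigma: "ennreal (rad_sum n x) \<le> const_B R * sigma_fn \<phi> m x"
proof -
  let ?F = "\<lambda>e. nonneg_inv \<phi> (1 / measure m (cball x e))"
  \<comment> \<open>The reciprocal of the constant in \<open>const_B R\<close>.\<close>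
  define c where "c = (R - 1) / R\<^sup>2"
  have c: "0 < c" using R_ge by (simp add: c_def)
  have cl: "0 \<le> c * lev (Suc k)" for k using c lev_pos[of "Suc k"] by simp
  have geo: "(\<Sum>k<Suc n. c * lev (Suc k)) \<le> lev n" for n
  proof -
    have "(\<Sum>k<Suc n. c * lev (Suc k)) = ((R - 1) * (\<Sum>k<Suc n. lev (Suc k))) / R\<^sup>2"
      by (simp add: c_def sum_distrib_left sum_divide_distrib del: sum.lessThan_Suc)
    also have "\<dots> \<le> lev (Suc (Suc n)) / R\<^sup>2"
      using sum_lev_le[of "Suc n"] by (rule divide_right_mono) simp
    also have "\<dots> = lev n" using R_ge by (simp add: lev_Suc power2_eq_square)
    finally show ?thesis .
  qed
  have pw: "(\<Sum>k<n. c * lev (Suc k) * indicator {0<..<rad k x} e) \<le> ?F e" if "0 < e" for n e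
  proof (induction n)
    case 0
    show ?case by (simp add: class_G_inv_nonneg[OF phi])
  next
    case (Suc n)
    show ?case
    proof (cases "e < rad n x")
      case True
      have "(\<Sum>k<Suc n. c * lev (Suc k) * indicator {0<..<rad k x} e) \<le> (\<Sum>k<Suc n. c * lev (Suc k))"
        using cl by (intro sum_mono) (auto simp: indicator_def)
      also have "\<dots> \<le> lev n" by (rule geo)
      also have "\<dots> \<le> ?F e" using less_rad[OF that True] by simp
      finally show ?thesis .
    next
      case False
      then show ?thesis using Suc by simp
    qed
  qed
  have "ennreal (c * rad_sum n x) = (\<Sum>k<n. ennreal (c * lev (Suc k) * rad k x))"
    using cl rad_nonneg by (subst sum_ennreal) (simp_all add: rad_sum_def sum_distrib_left mult.assoc[symmetric])
  also have "\<dots> = (\<Sum>k<n. \<integral>\<^sup>+ e. ennreal (c * lev (Suc k)) * indicator {0<..<rad k x} e \<partial>lborel)"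
    using cl rad_nonneg by (intro sum.cong refl) (simp add: nn_integral_cmult_indicator ennreal_mult)
  also have "\<dots> = (\<integral>\<^sup>+ e. (\<Sum>k<n. ennreal (c * lev (Suc k)) * indicator {0<..<rad k x} e) \<partial>lborel)"
    by (rule nn_integral_sum[symmetric]) simp
  also have "\<dots> \<le> sigma_fn \<phi> m x"
    unfolding sigma_fn_def
  proof (rule nn_integral_mono)
    fix e
    have eq: "(\<Sum>k<n. ennreal (c * lev (Suc k)) * indicator {0<..<rad k x} e) =
        ennreal (\<Sum>k<n. c * lev (Suc k) * indicator {0<..<rad k x} e)"
      using cl by (subst sum_ennreal[symmetric]) (auto intro!: sum.cong simp: indicator_def)
    show "(\<Sum>k<n. ennreal (c * lev (Suc k)) * indicator {0<..<rad k x} e) \<le>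
      ennreal (?F e) * indicator {\<epsilon>. 0 < \<epsilon> \<and> ennreal \<epsilon> \<le> ediameter (UNIV :: 'a set)} e"
    proof (cases "0 < e \<and> e \<le> D")
      case True
      then have "ennreal e \<le> ediameter (UNIV :: 'a set)"
        using D_le_ediameter by (meson ennreal_leI order_trans)
      then show ?thesis using True pw[of e n] eq by (simp add: ennreal_leI)
    next
      case False
      \<comment> \<open>Radii never exceed \<open>D\<close>, so restricting the integral to the
        diameter loses nothing.\<close>
      then have "indicator {0<..<rad k x} e = (0 :: ennreal)" for k
        using rad_le_D[of k x] by (auto simp: indicator_def)
      then show ?thesis by simp
    qed
  qed
  finally have "const_B R * ennreal (c * rad_sum n x) \<le> const_B R * sigma_fn \<phi> m x"
    by (rule mult_left_mono) simp
  moreover have "R\<^sup>2 / (R - 1) * (c * rad_sum n x) = rad_sum n x"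
    using R_ge by (simp add: c_def)
  ultimately show ?thesis
    using R_ge c rad_sum_nonneg[of n x] by (simp add: const_B_def flip: ennreal_mult)
qed

text \<open>The last term of \<open>chain_bound\<close> is at most the next summand of the weighted
  \<open>rad_sum\<close>. This gives the constant \<open>R\<^sup>2 / (R - 2)\<close>, at most
  \<open>const_A R\<close> because \<open>R - 1 \<le> R\<close>.\<close>

lemma chain_bound_le_sigma:
  assumes "2 < R"
  shows "ennreal (chain_bound l x) \<le> const_A R * sigma_fn \<phi> m x"
proof -
  have "chain_bound l x \<le> (R - 1) / (R - 2) * rad_sum (Suc l) x"
  proof -
    have "1 / (R - 2) * (lev (Suc l) * rad l x) \<le> (R - 1) / (R - 2) * (lev (Suc l) * rad l x)"
      using assms lev_pos[of "Suc l"] rad_nonneg[of l x] by (intro mult_right_mono divide_right_mono) auto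
    then show ?thesis by (simp add: chain_bound_def rad_sum_def distrib_left)
  qed
  then have "ennreal (chain_bound l x) \<le> ennreal ((R - 1) / (R - 2)) * ennreal (rad_sum (Suc l) x)"
    using assms rad_sum_nonneg[of "Suc l" x] by (simp add: ennreal_leI flip: ennreal_mult)
  also have "\<dots> \<le> ennreal ((R - 1) / (R - 2)) * (const_B R * sigma_fn \<phi> m x)"
    by (intro mult_left_mono rad_sum_le_sigma) simp
  also have "\<dots> = ennreal ((R - 1) / (R - 2) * (R\<^sup>2 / (R - 1))) * sigma_fn \<phi> m x"
    using assms by (subst ennreal_mult) (auto simp: const_B_def mult.assoc)
  also have "\<dots> \<le> const_A R * sigma_fn \<phi> m x"
  proof (rule mult_right_mono)
    have "(R - 1) / (R - 2) * (R\<^sup>2 / (R - 1)) = R\<^sup>2 * (R - 1) / ((R - 1) * (R - 2))" by simp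
    also have "\<dots> \<le> R ^ 3 / ((R - 1) * (R - 2))"
      using assms by (intro divide_right_mono) (auto simp: power2_eq_square power3_eq_cube)
    finally show "ennreal ((R - 1) / (R - 2) * (R\<^sup>2 / (R - 1))) \<le> const_A R"
      using assms by (simp add: const_A_def ennreal_leI)
  qed simp
  finally show ?thesis .
qed

text \<open>The index that makes \<open>osc l f x\<close> small depends on \<open>x\<close>, but the
  bounds for the other terms are uniform in \<open>l\<close>.\<close>

lemma deviation_le_sigma:
  fixes f :: "'a \<Rightarrow> real"
  assumes f: "continuous_on UNIV f" "bounded (range f)" and aR: "a = 0 \<or> 2 < R"
  shows "ennreal \<bar>f x - (LINT u|m. f u)\<bar> \<le>
    ennreal a * const_A R * sigma_fn \<phi> m x + ennreal b * (\<Sum>k. \<integral>\<^sup>+ w. loc_energy k f w \<partial>m)"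
proof (rule ennreal_le_epsilon)
  fix e :: real assume "0 < e"
  then obtain l where l: "osc l f x \<le> ennreal e" using osc_small[OF f(1)] by blast
  have "ennreal (a * chain_bound l x) \<le> ennreal a * (const_A R * sigma_fn \<phi> m x)"
    using aR a_nonneg chain_bound_nonneg[of l x] chain_bound_le_sigma[of l x]
    by (auto simp: ennreal_mult intro: mult_left_mono)
  moreover have "(\<Sum>k<l. \<integral>\<^sup>+ w. loc_energy k f w \<partial>m) \<le> (\<Sum>k. \<integral>\<^sup>+ w. loc_energy k f w \<partial>m)"
    by (rule sum_le_suminf) auto
  ultimately have "osc l f x + (ennreal (a * chain_bound l x) + ennreal b * (\<Sum>k<l. \<integral>\<^sup>+ w. loc_energy k f w \<partial>m))
    \<le> ennreal e + (ennreal a * (const_A R * sigma_fn \<phi> m x) + ennreal b * (\<Sum>k. \<integral>\<^sup>+ w. loc_energy k f w \<partial>m))"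
    by (intro add_mono l mult_left_mono) auto
  with deviation_le[OF f aR, of x l]
  show "ennreal \<bar>f x - (LINT u|m. f u)\<bar> \<le>
    ennreal a * const_A R * sigma_fn \<phi> m x + ennreal b * (\<Sum>k. \<integral>\<^sup>+ w. loc_energy k f w \<partial>m) + ennreal e"
    by (simp add: ac_simps)
qed

section \<open>The measure on pairs\<close>

definition dens :: "'a \<times> 'a \<Rightarrow> ennreal" where
  "dens p = (\<Sum>k. ennreal (lev (Suc k) * rad k (fst p)) * ker k (fst p) (snd p))"

definition mass :: ennreal where
  "mass = (\<integral>\<^sup>+ p. dens p \<partial>(m \<Otimes>\<^sub>M m))"

lemma measurable_dens [measurable]: "dens \<in> borel_measurable (m \<Otimes>\<^sub>M m)"
proof -
  note measurable_ker [measurable]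
  show ?thesis unfolding dens_def by measurable
qed

text \<open>Tonelli, one level at a time. For \<open>g\<close> the \<open>\<phi>\<close>-quotient of
  \<open>f\<close>, the right side is the sum of the integrated local energies.\<close>

lemma nn_integral_dens_mult:
  assumes [measurable]: "g \<in> borel_measurable (m \<Otimes>\<^sub>M m)"
  shows "(\<integral>\<^sup>+ p. dens p * g p \<partial>(m \<Otimes>\<^sub>M m)) =
    (\<Sum>k. \<integral>\<^sup>+ w. ennreal (lev (Suc k) * rad k w) * avg k (\<lambda>v. g (w, v)) w \<partial>m)"
proof -
  note measurable_ker [measurable]
  have "(\<integral>\<^sup>+ p. dens p * g p \<partial>(m \<Otimes>\<^sub>M m)) =
      (\<integral>\<^sup>+ p. (\<Sum>k. ennreal (lev (Suc k) * rad k (fst p)) * ker k (fst p) (snd p) * g p) \<partial>(m \<Otimes>\<^sub>M m))"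
    by (simp add: dens_def)
  also have "\<dots> = (\<Sum>k. \<integral>\<^sup>+ p. ennreal (lev (Suc k) * rad k (fst p)) * ker k (fst p) (snd p) * g p \<partial>(m \<Otimes>\<^sub>M m))"
    by (rule nn_integral_suminf) measurable
  also have "\<dots> = (\<Sum>k. \<integral>\<^sup>+ w. ennreal (lev (Suc k) * rad k w) * avg k (\<lambda>v. g (w, v)) w \<partial>m)"
  proof (rule suminf_cong)
    fix k
    have "(\<integral>\<^sup>+ p. ennreal (lev (Suc k) * rad k (fst p)) * ker k (fst p) (snd p) * g p \<partial>(m \<Otimes>\<^sub>M m)) =
        (\<integral>\<^sup>+ w. \<integral>\<^sup>+ v. ennreal (lev (Suc k) * rad k w) * ker k w v * g (w, v) \<partial>m \<partial>m)"
      by (subst nn_integral_fst[symmetric]) simp_all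
    also have "\<dots> = (\<integral>\<^sup>+ w. ennreal (lev (Suc k) * rad k w) * avg k (\<lambda>v. g (w, v)) w \<partial>m)"
    proof (rule nn_integral_cong)
      fix w
      have [measurable]: "(\<lambda>v. g (w, v)) \<in> borel_measurable m" by measurable
      show "(\<integral>\<^sup>+ v. ennreal (lev (Suc k) * rad k w) * ker k w v * g (w, v) \<partial>m) =
          ennreal (lev (Suc k) * rad k w) * avg k (\<lambda>v. g (w, v)) w"
        unfolding avg_def by (subst nn_integral_cmult[symmetric]) (auto simp: ac_simps)
    qed
    finally show "(\<integral>\<^sup>+ p. ennreal (lev (Suc k) * rad k (fst p)) * ker k (fst p) (snd p) * g p \<partial>(m \<Otimes>\<^sub>M m)) =
        (\<integral>\<^sup>+ w. ennreal (lev (Suc k) * rad k w) * avg k (\<lambda>v. g (w, v)) w \<partial>m)" .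
  qed
  finally show ?thesis .
qed

lemma mass_eq: "mass = (\<Sum>k. \<integral>\<^sup>+ w. ennreal (lev (Suc k) * rad k w) \<partial>m)"
  using nn_integral_dens_mult[of "\<lambda>_. 1"] by (simp add: mass_def avg_const)

text \<open>\<open>sigma_fn\<close> is not known to be measurable here, so the constant is moved to the measurable side
  before integrating.\<close>

lemma mass_le: "mass \<le> const_B R * S_bar \<phi> m"
proof -
  define c where "c = R\<^sup>2 / (R - 1)"
  have c: "0 < c" using R_ge by (simp add: c_def)
  have c1: "ennreal c * (ennreal (1 / c) * z) = z" "ennreal (1 / c) * (ennreal c * z) = z" for z
    using c by (simp_all add: mult.assoc[symmetric] flip: ennreal_mult)
  define h where "h w = (\<Sum>k. ennreal (lev (Suc k) * rad k w))" for w
  have [measurable]: "h \<in> borel_measurable m" unfolding h_def by measurable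
  have "h w \<le> ennreal c * sigma_fn \<phi> m w" for w
    unfolding h_def suminf_eq_SUP
  proof (rule SUP_least)
    fix n
    have "(\<Sum>k<n. ennreal (lev (Suc k) * rad k w)) = ennreal (rad_sum n w)"
      using lev_pos rad_nonneg unfolding rad_sum_def by (intro sum_ennreal mult_nonneg_nonneg less_imp_le[OF lev_pos]) auto
    then show "(\<Sum>k<n. ennreal (lev (Suc k) * rad k w)) \<le> ennreal c * sigma_fn \<phi> m w"
      using rad_sum_le_sigma[of n w] by (simp add: const_B_def c_def)
  qed
  then have "ennreal (1 / c) * h w \<le> ennreal (1 / c) * (ennreal c * sigma_fn \<phi> m w)" for w
    by (intro mult_left_mono) auto
  then have le: "ennreal (1 / c) * h w \<le> sigma_fn \<phi> m w" for w
    by (simp only: c1)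
  have "mass = (\<integral>\<^sup>+ w. h w \<partial>m)"
    unfolding mass_eq h_def by (rule nn_integral_suminf[symmetric]) measurable
  also have "\<dots> = ennreal c * (\<integral>\<^sup>+ w. ennreal (1 / c) * h w \<partial>m)"
    by (simp add: nn_integral_cmult c1)
  also have "\<dots> \<le> ennreal c * S_bar \<phi> m"
    unfolding S_bar_def by (intro mult_left_mono nn_integral_mono le) simp
  finally show ?thesis by (simp add: const_B_def c_def)
qed

text \<open>The level 0 term suffices: \<open>rad 0 w = 0\<close> would put all the mass on
  \<open>{w}\<close>, against full support when there is a second point.\<close>

lemma mass_nonzero:
  assumes "(y :: 'a) \<noteq> z"
  shows "mass \<noteq> 0"
proof
  assume "mass = 0"
  have pos: "rad 0 w \<noteq> 0" for w
  proof
    assume "rad 0 w = 0"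
    then have one: "measure m {w} = 1"
      using measure_cball_rad[of 0 w] phi_lev_0 prob_le_1[of "{w}"] by simp
    obtain u where "u \<noteq> w" using assms by metis
    then have "0 < measure m (- {w})" by (intro measure_open_pos[of _ u]) auto
    moreover have "measure m (- {w}) = 1 - measure m {w}"
      using prob_compl[of "{w}"] by (simp add: Compl_eq_Diff_UNIV)
    ultimately show False using one by simp
  qed
  have "(\<integral>\<^sup>+ w. ennreal (lev (Suc 0) * rad 0 w) \<partial>m) = 0"
    using \<open>mass = 0\<close> unfolding mass_eq by (simp add: suminf_eq_zero_iff)
  then have "AE w in m. ennreal (lev (Suc 0) * rad 0 w) = 0"
    by (subst (asm) nn_integral_0_iff_AE) auto
  then have "AE w in m. False"
  proof eventually_elim
    case (elim w)
    have "0 < lev (Suc 0) * rad 0 w"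
      using pos[of w] rad_nonneg[of 0 w] lev_pos[of "Suc 0"] by (simp add: less_le)
    then show ?case using elim by auto
  qed
  then show False by simp
qed

text \<open>Finiteness of \<open>S_bar\<close> makes \<open>mass\<close> finite and the second point
  makes it nonzero, so \<open>dens\<close> can be normalised. Undoing this costs the factor
  \<open>mass\<close>, bounded by \<open>mass_le\<close>.\<close>

lemma chaining_measure:
  assumes fin: "S_bar \<phi> m \<noteq> \<infinity>" and yz: "(y :: 'a) \<noteq> z"
  shows "\<exists>\<nu> :: ('a \<times> 'a) measure. prob_space \<nu> \<and> sets \<nu> = sets borel \<and>
    (\<forall>f t. continuous_on UNIV f \<and> bounded (range f) \<longrightarrow>
       ennreal \<bar>f t - (LINT u|m. f u)\<bar>
         \<le> ennreal a * const_A R * sigma_fn \<phi> m t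
            + ennreal b * const_B R * S_bar \<phi> m * phi_energy \<phi> \<nu> f)"
proof -
  have mass: "mass \<noteq> 0" "mass \<noteq> top"
  proof -
    show "mass \<noteq> 0" by (rule mass_nonzero[OF yz])
    have "const_B R * S_bar \<phi> m \<noteq> top"
      using fin by (simp add: const_B_def ennreal_mult_eq_top_iff)
    then show "mass \<noteq> top" using mass_le neq_top_trans by blast
  qed
  define \<nu> where "\<nu> = density (m \<Otimes>\<^sub>M m) (\<lambda>p. dens p / mass)"
  have "prob_space \<nu>"
  proof (rule prob_spaceI)
    have "emeasure \<nu> (space \<nu>) = (\<integral>\<^sup>+ p. dens p / mass \<partial>(m \<Otimes>\<^sub>M m))"
      unfolding \<nu>_def space_density by (subst emeasure_density) (auto intro!: nn_integral_cong)
    also have "\<dots> = mass / mass" unfolding mass_def by (rule nn_integral_divide) measurable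
    also have "\<dots> = 1" using mass by (simp add: ennreal_divide_self less_top)
    finally show "emeasure \<nu> (space \<nu>) = 1" .
  qed
  moreover have "sets \<nu> = sets borel" by (simp add: \<nu>_def sets_pair_borel)
  moreover have "ennreal \<bar>f t - (LINT u|m. f u)\<bar> \<le> ennreal a * const_A R * sigma_fn \<phi> m t
      + ennreal b * const_B R * S_bar \<phi> m * phi_energy \<phi> \<nu> f"
    if f: "continuous_on UNIV f" "bounded (range f)" for f t
  proof (cases "a = 0 \<or> 2 < R")
    case True
    let ?q = "\<lambda>p. ennreal (\<phi> (\<bar>f (fst p) - f (snd p)\<bar> / dist (fst p) (snd p)))"
    note measurable_class_G_quotient[OF phi f(1), measurable]
    have "(\<Sum>k. \<integral>\<^sup>+ w. loc_energy k f w \<partial>m) = (\<integral>\<^sup>+ p. dens p * ?q p \<partial>(m \<Otimes>\<^sub>M m))"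
      by (subst nn_integral_dens_mult) (auto simp: loc_energy_def[abs_def])
    also have "\<dots> = (\<integral>\<^sup>+ p. mass * (dens p / mass * ?q p) \<partial>(m \<Otimes>\<^sub>M m))"
    proof (rule nn_integral_cong)
      fix p
      have "mass * (dens p / mass) = dens p"
        using mass by (metis ennreal_times_divide mult.commute ennreal_mult_divide_eq)
      then show "dens p * ?q p = mass * (dens p / mass * ?q p)" by (simp add: mult.assoc[symmetric])
    qed
    also have "\<dots> = mass * (\<integral>\<^sup>+ p. dens p / mass * ?q p \<partial>(m \<Otimes>\<^sub>M m))"
      by (rule nn_integral_cmult) measurable
    also have "(\<integral>\<^sup>+ p. dens p / mass * ?q p \<partial>(m \<Otimes>\<^sub>M m)) = phi_energy \<phi> \<nu> f"
      unfolding phi_energy_fst_snd \<nu>_def by (rule nn_integral_density[symmetric]) measurable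
    also have "mass * phi_energy \<phi> \<nu> f \<le> const_B R * S_bar \<phi> m * phi_energy \<phi> \<nu> f"
      by (intro mult_right_mono mass_le) simp
    finally have "ennreal b * (\<Sum>k. \<integral>\<^sup>+ w. loc_energy k f w \<partial>m) \<le>
        ennreal b * (const_B R * S_bar \<phi> m * phi_energy \<phi> \<nu> f)"
      by (rule mult_left_mono) simp
    then show ?thesis
      using deviation_le_sigma[OF f True, of t] by (simp add: mult.assoc add_left_mono order_trans)
  next
    case False
    \<comment> \<open>Here \<open>a > 0\<close> and \<open>R = 2\<close>, so
      \<open>const_A R\<close> is infinite; as \<open>sigma_fn\<close> is positive at
      \<open>t\<close>, so is the whole right side infinite.\<close>
    have "0 < D" using dist_le[of y z] yz by (meson less_le_trans zero_less_dist_iff)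
    then have "0 < ennreal (nonneg_inv \<phi> 1 * D)" using class_G_inv_one_pos[OF phi] by simp
    also have "\<dots> \<le> sigma_fn \<phi> m t"
      using \<open>0 < D\<close> by (intro sigma_fn_ge[OF phi] D_le_ediameter) simp
    finally have "ennreal a * const_A R * sigma_fn \<phi> m t = \<infinity>"
      using False a_nonneg R_ge by (auto simp: const_A_def ennreal_mult_top ennreal_top_mult ennreal_mult_eq_top_iff)
    then show ?thesis by simp
  qed
  ultimately show ?thesis by blast
qed

end

section \<open>Infinite or degenerate cases, and the inequality for \<psi>\<close>

context full_support_prob
begin

lemma const_deviation:
  fixes f :: "'a \<Rightarrow> real"
  assumes "\<And>x y. f x = f y"
  shows "f t - (LINT u|m. f u) = 0"
proof -
  have "f = (\<lambda>_. f t)" using assms by auto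
  then have "(LINT u|m. f u) = (LINT u|m. f t)" by metis
  then show ?thesis using prob_space by simp
qed

lemma S_bar_le_S_sup: "S_bar \<phi> m \<le> S_sup \<phi> m"
proof -
  have "S_bar \<phi> m \<le> (\<integral>\<^sup>+ u. S_sup \<phi> m \<partial>m)"
    unfolding S_bar_def S_sup_def by (intro nn_integral_mono SUP_upper) simp
  then show ?thesis using emeasure_space_1 by simp
qed

text \<open>If \<open>S_bar\<close> is finite, \<open>sigma_fn_ge\<close> forces a finite diameter
  and the chaining measure is available, provided there are two points. Otherwise the product
  measure serves.\<close>

lemma deviation_measure:
  assumes phi: "\<phi> \<in> class_G a b" and ab: "0 \<le> a" "0 \<le> b" and R: "2 \<le> R"
  shows "\<exists>\<nu> :: ('a \<times> 'a) measure. prob_space \<nu> \<and> sets \<nu> = sets borel \<and>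
    (\<forall>f t. continuous_on UNIV f \<and> bounded (range f) \<longrightarrow>
       ennreal \<bar>f t - (LINT u|m. f u)\<bar>
         \<le> ennreal a * const_A R * sigma_fn \<phi> m t
            + ennreal b * const_B R * S_bar \<phi> m * phi_energy \<phi> \<nu> f)"
proof (cases "S_bar \<phi> m \<noteq> \<infinity> \<and> (\<exists>y z :: 'a. y \<noteq> z)")
  case True
  then obtain y z :: 'a where yz: "y \<noteq> z" by blast
  define D where "D = enn2real (ediameter (UNIV :: 'a set))"
  have "ediameter (UNIV :: 'a set) \<noteq> \<infinity>"
  proof
    assume inf: "ediameter (UNIV :: 'a set) = \<infinity>"
    have "sigma_fn \<phi> m x = \<infinity>" for x
    proof (rule ccontr)
      assume "sigma_fn \<phi> m x \<noteq> \<infinity>"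
      then obtain s where s: "0 \<le> s" "sigma_fn \<phi> m x = ennreal s"
        by (cases "sigma_fn \<phi> m x") auto
      \<comment> \<open>Chosen so that the lower bound of \<open>sigma_fn_ge\<close> is
        \<open>s + 1\<close>.\<close>
      let ?d = "(s + 1) / nonneg_inv \<phi> 1"
      have "ennreal (nonneg_inv \<phi> 1 * ?d) \<le> sigma_fn \<phi> m x"
        using s(1) class_G_inv_one_pos[OF phi] by (intro sigma_fn_ge[OF phi]) (auto simp: inf)
      then show False using s class_G_inv_one_pos[OF phi] by (simp add: ennreal_le_iff)
    qed
    then have "S_bar \<phi> m = (\<integral>\<^sup>+ u. \<infinity> \<partial>m)" by (simp add: S_bar_def)
    then have "S_bar \<phi> m = \<infinity>" using emeasure_space_1 by simp
    then show False using True by simp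
  qed
  then have D: "ennreal D = ediameter (UNIV :: 'a set)" by (simp add: D_def less_top)
  have D0: "0 \<le> D" by (simp add: D_def)
  have dist: "dist u v \<le> D" for u v :: 'a
  proof -
    have "ennreal (dist u v) \<le> ediameter (UNIV :: 'a set)"
      unfolding ediameter_def by (rule SUP_upper2[of "(u, v)"]) auto
    then show ?thesis using D0 by (simp add: D[symmetric] ennreal_le_iff)
  qed
  interpret chaining m \<phi> a b R D
    by unfold_locales (use phi ab R dist D in auto)
  show ?thesis using chaining_measure[OF _ yz] True by blast
next
  case False
  \<comment> \<open>The right-hand side is infinite as soon as the energy is nonzero, and the product measure detects
    non-constant functions.\<close>
  interpret P: pair_prob_space m m ..
  have "ennreal \<bar>f t - (LINT u|m. f u)\<bar> \<le> ennreal a * const_A R * sigma_fn \<phi> m t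
      + ennreal b * const_B R * S_bar \<phi> m * phi_energy \<phi> (m \<Otimes>\<^sub>M m) f"
    if f: "continuous_on UNIV f" for f t
  proof (cases "(\<forall>x y :: 'a. x = y) \<or> phi_energy \<phi> (m \<Otimes>\<^sub>M m) f = 0")
    case True
    then have "f x = f y" for x y
      using phi_energy_product_eq_0[OF phi f] by metis
    then show ?thesis using const_deviation[of f t] by simp
  next
    case nz: False
    then have "S_bar \<phi> m = \<infinity>" using False by blast
    moreover have "ennreal b * const_B R \<noteq> 0"
      using class_G_b_pos[OF phi ab] R by (auto simp: const_B_def)
    ultimately have "ennreal b * const_B R * S_bar \<phi> m * phi_energy \<phi> (m \<Otimes>\<^sub>M m) f = \<infinity>"
      using nz by (simp add: ennreal_mult_top ennreal_top_mult)
    then show ?thesis by simp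
  qed
  then show ?thesis
    using P.prob_space_axioms sets_pair_borel by (intro exI[of _ "m \<Otimes>\<^sub>M m"]) auto
qed

lemma psi_deviation_le:
  fixes \<nu> :: "('a \<times> 'a) measure" and \<psi> :: "real \<Rightarrow> real"
  assumes phi: "\<phi> \<in> class_G a b" and ab: "0 \<le> a" "0 \<le> b" and R: "2 \<le> R"
    and nu: "sets \<nu> = sets borel"
    and dev: "\<And>f t. continuous_on UNIV f \<Longrightarrow> bounded (range f) \<Longrightarrow>
       ennreal \<bar>f t - (LINT u|m. f u)\<bar>
         \<le> ennreal a * const_A R * sigma_fn \<phi> m t
            + ennreal b * const_B R * S_bar \<phi> m * phi_energy \<phi> \<nu> f"
    and psi: "\<psi> 0 = 0" "0 \<le> \<alpha>" "0 \<le> \<beta>" "\<And>x y. 0 \<le> x \<Longrightarrow> 0 < y \<Longrightarrow> \<psi> x \<le> \<alpha> + \<beta> * (\<phi> (x * y) / \<phi> y)"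
    and f: "continuous_on UNIV f" "bounded (range f)"
  shows "ennreal (\<psi> (enn2real (ennreal \<bar>f t - (LINT u|m. f u)\<bar> / const_K a b R \<phi> m)))
    \<le> ennreal \<alpha> + ennreal \<beta> * phi_energy \<phi> \<nu> f"
proof -
  define X where "X = \<bar>f t - (LINT u|m. f u)\<bar>"
  define K where "K = const_K a b R \<phi> m"
  define l where "l = enn2real (ennreal X / K)"
  show ?thesis
  proof (cases "l = 0")
    \<comment> \<open>This covers \<open>X = 0\<close> as well as \<open>K = 0\<close> and
      \<open>K = \<infinity>\<close>, since \<open>enn2real\<close> sends \<open>\<infinity>\<close>
      to 0.\<close>
    case True
    then show ?thesis using psi(1) by (simp add: l_def X_def K_def)
  next
    case False
    have X: "0 < X" using False by (auto simp: l_def X_def less_le)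
    have K: "K \<noteq> \<infinity>" "K \<noteq> 0"
      using False X by (auto simp: l_def)
    obtain \<kappa> where kappa: "0 \<le> \<kappa>" "K = ennreal \<kappa>" using K(1) by (cases K) auto
    then have kpos: "0 < \<kappa>" using K(2) by (cases "\<kappa> = 0") auto
    have l: "l = X / \<kappa>" "0 < l"
      using X kpos by (auto simp: l_def kappa divide_ennreal)
    define P Q where "P = ennreal a * const_A R * S_sup \<phi> m" and "Q = ennreal b * const_B R * S_sup \<phi> m"
    have KPQ: "K = P + Q" by (simp add: K_def const_K_def P_def Q_def distrib_right)
    have bB: "ennreal b * const_B R \<noteq> 0"
      using class_G_b_pos[OF phi ab] R by (auto simp: const_B_def)
    have PQ: "P \<noteq> \<infinity>" "Q \<noteq> \<infinity>" using K(1) by (auto simp: KPQ)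
    have "S_sup \<phi> m \<noteq> 0" using K(2) by (auto simp: KPQ P_def Q_def)
    then have Q0: "Q \<noteq> 0" using bB by (simp add: Q_def)
    \<comment> \<open>Scaling by \<open>l\<close> makes the deviation at \<open>t\<close> equal to
      \<open>K = P + Q\<close>. After cancelling the finite \<open>P\<close>, the first inequality
      leaves \<open>Q \<le> Q * I\<close>, hence \<open>1 \<le> I\<close>.\<close>
    let ?g = "\<lambda>u. f u / l"
    have g: "continuous_on UNIV ?g" "bounded (range ?g)"
    proof -
      show "continuous_on UNIV ?g" using l(2) by (intro continuous_intros f(1)) auto
      show "bounded (range ?g)"
        using bounded_scaling[OF f(2), of "1 / l"] by (simp add: image_image)
    qed
    define I where "I = phi_energy \<phi> \<nu> ?g"
    have "?g t - (LINT u|m. ?g u) = (f t - (LINT u|m. f u)) / l"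
      by (simp add: diff_divide_distrib)
    then have "\<bar>?g t - (LINT u|m. ?g u)\<bar> = X / l" using l(2) by (simp add: X_def)
    also have "\<dots> = \<kappa>" using X kpos by (simp add: l(1))
    finally have "K \<le> ennreal a * const_A R * sigma_fn \<phi> m t + ennreal b * const_B R * S_bar \<phi> m * I"
      using dev[OF g, of t] by (simp add: kappa(2) I_def)
    also have "\<dots> \<le> P + Q * I"
      unfolding P_def Q_def
      by (intro add_mono mult_left_mono mult_right_mono S_bar_le_S_sup) (auto simp: S_sup_def intro: SUP_upper)
    finally have "Q \<le> Q * I" using PQ(1) by (simp add: KPQ ennreal_add_left_cancel_le)
    then have I1: "1 \<le> I"
      using Q0 PQ(2) ennreal_mult_le_mult_iff[of Q 1 I] by simp
    have pw: "ennreal (\<psi> l - \<alpha>) * ennreal (\<phi> (\<bar>f u / l - f v / l\<bar> / dist u v)) \<le>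
        ennreal \<beta> * ennreal (\<phi> (\<bar>f u - f v\<bar> / dist u v))" for u v
    proof -
      define q where "q = \<bar>f u - f v\<bar> / dist u v"
      have q: "0 \<le> q" by (simp add: q_def)
      have eq: "\<bar>f u / l - f v / l\<bar> / dist u v = q / l"
        using l(2) by (simp add: q_def flip: diff_divide_distrib)
      have "(\<psi> l - \<alpha>) * \<phi> (q / l) \<le> \<beta> * \<phi> q"
      \<comment> \<open>For \<open>q > 0\<close> the hypothesis on \<open>\<psi>\<close> is applied
        at \<open>y = q / l\<close>, so that \<open>l * y = q\<close>.\<close>
      proof (cases "q = 0")
        case False
        then have ql: "0 < q / l" using q l(2) by simp
        have "0 < \<phi> (q / l)"
          using class_G_less_iff[OF phi, of 0 "q / l"] class_G_zero[OF phi] ql by simp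
        moreover have "\<psi> l - \<alpha> \<le> \<beta> * \<phi> q / \<phi> (q / l)"
          using psi(4)[of l "q / l"] l(2) ql by simp
        ultimately show ?thesis by (simp add: pos_le_divide_eq)
      qed (simp add: class_G_zero[OF phi])
      then have "ennreal ((\<psi> l - \<alpha>) * \<phi> (q / l)) \<le> ennreal (\<beta> * \<phi> q)" by (rule ennreal_leI)
      moreover have "0 \<le> \<phi> (q / l)" "0 \<le> \<phi> q"
        using q l(2) by (auto intro!: class_G_nonneg[OF phi])
      ultimately show ?thesis
        unfolding eq q_def[symmetric] using psi(3) by (simp add: ennreal_mult' ennreal_mult'')
    qed
    have meas: "borel_measurable \<nu> = borel_measurable (m \<Otimes>\<^sub>M m)"
      by (rule measurable_cong_sets) (simp_all add: nu sets_pair_borel)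
    have "ennreal (\<psi> l - \<alpha>) \<le> ennreal (\<psi> l - \<alpha>) * I"
      using mult_left_mono[OF I1, of "ennreal (\<psi> l - \<alpha>)"] by simp
    also have "\<dots> = (\<integral>\<^sup>+ p. ennreal (\<psi> l - \<alpha>) * ennreal (\<phi> (\<bar>f (fst p) / l - f (snd p) / l\<bar> / dist (fst p) (snd p))) \<partial>\<nu>)"
      unfolding I_def phi_energy_fst_snd
      by (rule nn_integral_cmult[symmetric]) (use measurable_class_G_quotient[OF phi g(1)] in \<open>simp add: meas\<close>)
    also have "\<dots> \<le> (\<integral>\<^sup>+ p. ennreal \<beta> * ennreal (\<phi> (\<bar>f (fst p) - f (snd p)\<bar> / dist (fst p) (snd p))) \<partial>\<nu>)"
      by (intro nn_integral_mono pw)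
    also have "\<dots> = ennreal \<beta> * phi_energy \<phi> \<nu> f"
      unfolding phi_energy_fst_snd
      by (rule nn_integral_cmult) (use measurable_class_G_quotient[OF phi f(1)] in \<open>simp add: meas\<close>)
    finally have *: "ennreal (\<psi> l - \<alpha>) \<le> ennreal \<beta> * phi_energy \<phi> \<nu> f" .
    \<comment> \<open>\<open>ennreal\<close> truncates \<open>\<psi> l - \<alpha>\<close> at 0, so
      the negative case is separate.\<close>
    have "ennreal (\<psi> l) \<le> ennreal \<alpha> + ennreal (\<psi> l - \<alpha>)"
    proof (cases "\<alpha> \<le> \<psi> l")
      case True
      then show ?thesis using psi(2) by (simp flip: ennreal_plus)
    next
      case False
      then have "ennreal (\<psi> l) \<le> ennreal \<alpha>" by (intro ennreal_leI) simp
      then show ?thesis by (simp add: add_increasing2)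
    qed
    also have "\<dots> \<le> ennreal \<alpha> + ennreal \<beta> * phi_energy \<phi> \<nu> f" using * by (rule add_left_mono)
    finally show ?thesis by (simp add: l_def X_def K_def)
  qed
qed

end

theorem theorem2p1:
  fixes m :: "'a::metric_space measure"
    and a b R :: real
    and \<phi> :: "real \<Rightarrow> real"
  assumes "prob_space m"
    and "sets m = sets borel"
    and "msupport m = UNIV"
    and "a \<ge> 0" and "b \<ge> 0"
    and "\<phi> \<in> class_G a b"
    and "R \<ge> 2"
  shows "\<exists>\<nu> :: ('a \<times> 'a) measure.
    prob_space \<nu> \<and> sets \<nu> = sets borel \<and>
    (\<forall>f t. continuous_on UNIV f \<and> bounded (range f) \<longrightarrow>
       ennreal \<bar>f t - (LINT u|m. f u)\<bar>
         \<le> ennreal a * const_A R * sigma_fn \<phi> m t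
            + ennreal b * const_B R * S_bar \<phi> m * phi_energy \<phi> \<nu> f) \<and>
    (\<forall>\<psi> :: real \<Rightarrow> real. \<forall>\<alpha> \<beta> :: real.
       mono_on {0..} \<psi> \<and> continuous_on {0..} \<psi> \<and> \<psi> 0 = 0 \<and> \<alpha> \<ge> 0 \<and> \<beta> \<ge> 0 \<and>
       (\<forall>x\<ge>0. \<forall>y>0. \<psi> x \<le> \<alpha> + \<beta> * (\<phi> (x * y) / \<phi> y)) \<longrightarrow>
       (\<forall>f. continuous_on UNIV f \<and> bounded (range f) \<longrightarrow>
          (SUP t. ennreal (\<psi> (enn2real (ennreal \<bar>f t - (LINT u|m. f u)\<bar> / const_K a b R \<phi> m))))
            \<le> ennreal \<alpha> + ennreal \<beta> * phi_energy \<phi> \<nu> f))"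
proof -
  interpret full_support_prob m
    using assms(1-3) by (intro full_support_prob.intro full_support_prob_axioms.intro)
  obtain \<nu> :: "('a \<times> 'a) measure" where nu: "prob_space \<nu>" "sets \<nu> = sets borel"
    and dev: "\<forall>f t. continuous_on UNIV f \<and> bounded (range f) \<longrightarrow>
       ennreal \<bar>f t - (LINT u|m. f u)\<bar>
         \<le> ennreal a * const_A R * sigma_fn \<phi> m t
            + ennreal b * const_B R * S_bar \<phi> m * phi_energy \<phi> \<nu> f"
    using deviation_measure[OF assms(6,4,5,7)] by blast
  show ?thesis
  \<comment> \<open>The inequality for \<psi> follows from the first one for the same \<nu>, at each
    \<open>t\<close>, hence for the supremum.\<close>
  proof (intro exI[of _ \<nu>] conjI nu dev allI impI SUP_least)
    fix \<psi> :: "real \<Rightarrow> real" and \<alpha> \<beta> and f :: "'a \<Rightarrow> real" and t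
    assume "mono_on {0..} \<psi> \<and> continuous_on {0..} \<psi> \<and> \<psi> 0 = 0 \<and> \<alpha> \<ge> 0 \<and> \<beta> \<ge> 0 \<and>
       (\<forall>x\<ge>0. \<forall>y>0. \<psi> x \<le> \<alpha> + \<beta> * (\<phi> (x * y) / \<phi> y))"
      and "continuous_on UNIV f \<and> bounded (range f)"
    then show "ennreal (\<psi> (enn2real (ennreal \<bar>f t - (LINT u|m. f u)\<bar> / const_K a b R \<phi> m)))
        \<le> ennreal \<alpha> + ennreal \<beta> * phi_energy \<phi> \<nu> f"
      using dev by (intro psi_deviation_le[OF assms(6,4,5,7) nu(2)]) auto
  qed
qed

end
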